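(* Let $(\tilde M^{n+p},\tilde F)$ be a Randers manifold with navigation data $(\tilde h,\tilde W)$, where $\tilde W$ is a Killing vector field of $\tilde h$, and let $f:M^n\to(\tilde M^{n+p},\tilde F)$ be a submanifold isometrically immersed, locally given by $\tilde x^\alpha=f^\alpha(x^1,\dots,x^n)$. Then the BH-mean curvature form (resp. the HT-mean curvature form) $\mathcal H_f=\mathcal H_\gamma d\tilde x^\gamma$ of $f$ is given by \begin{align*} \mathcal H_\gamma={}&\frac{2(\log\chi)'}{\varrho}\Big[2\varrho' B^{\eta\delta}\tilde W_\delta\tilde W_\tau(\delta^\tau_\gamma-B^\tau_\gamma)-\varrho(\delta^\eta_\gamma-B^\eta_\gamma)\Big]\tilde W_{\alpha|\eta}\tilde W^\alpha\\ &-\frac1{\varrho}\Big\{4\varrho'B^{\eta\beta}\tilde W_{\alpha|\eta}\tilde W_\beta(\delta^\alpha_\gamma-B^\alpha_\gamma)-2\Big[2\varrho''B^{\eta\delta}\tilde W_\delta\tilde W_\tau(\delta^\tau_\gamma-B^\tau_\gamma)-\varrho'(\delta^\eta_\gamma-B^\eta_\gamma)\Big]\tilde W_{\alpha|\eta}\tilde W^\alpha\Big\}\\ &-\frac1{\varrho}\Big\{h^{ij}\Big[2\varrho'\tilde W_\alpha\tilde W_\beta(\delta^\beta_\gamma-B^\beta_\gamma)+\varrho\tilde h_{\gamma\alpha}\Big]+2\tilde W_\delta\tilde W_\tau A^{i\delta}A^{j\tau}\Big[2\varrho''\tilde W_\alpha\tilde W_\beta(\delta^\beta_\gamma-B^\beta_\gamma)-\varrho'\tilde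 h_{\gamma\alpha}\Big]\Big\}\tau^\alpha_{ij}. \end{align*}
   Context: Navigation data: $\tilde h$ is a Riemannian metric on $\tilde M$ and $\tilde W$ a vector field with $\|\tilde W\|_{\tilde h}<1$; the Randers metric is $\tilde F(\tilde x,y)=\big(\sqrt{\lambda\,\tilde h(y,y)+\tilde h(\tilde W,y)^2}-\tilde h(\tilde W,y)\big)/\lambda$ with $\lambda=1-\|\tilde W\|^2_{\tilde h}$; $M$ carries the induced metric $f^*\tilde F$. Index ranges $1\le i,j,k\le n$, $1\le\alpha,\beta,\gamma,\eta,\delta,\tau\le n+p$, summation convention. Notation: $z^\alpha_i=\partial f^\alpha/\partial x^i$, $\tilde W_\alpha=\tilde h_{\alpha\beta}\tilde W^\beta$, $h_{ij}=\tilde h_{\alpha\beta}z^\alpha_iz^\beta_j$, $(h^{ij})=(h_{ij})^{-1}$, $W_i=\tilde W_\alpha z^\alpha_i$, $\|W\|^2_h=h^{ij}W_iW_j$, $\mathfrak s=1-\|\tilde W\|^2_{\tilde h}+\|W\|^2_h$, $A^{i\alpha}=h^{ij}z^\alpha_j$, $B^{\alpha\beta}=h^{ij}z^\alpha_iz^\beta_j$, $B^\alpha_\beta=B^{\alpha\delta}\tilde h_{\delta\beta}$. $\tilde W^\beta_{|\eta}$ are the components of $\nabla^{\tilde h}\tilde W$, $\tilde W_{\alpha|\eta}=\tilde h_{\alpha\beta}\tilde W^\beta_{|\eta}$. $\tau^\alpha_{ij}=\frac{\partial^2f^\alpha}{\partial x^i\partial x^j}+\tilde\Gamma^\alpha_{\tau\delta}z^\tau_jz^\delta_i-\Gamma^k_{ij}z^\alpha_k$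 is the second fundamental form of $f:(M,h)\to(\tilde M,\tilde h)$. Volume data: $(\varrho,\chi)=(\mathfrak s^{-n/2},1)$ in the Busemann–Hausdorff (BH) case and $(\varrho,\chi)=(\mathfrak s^{1/2},(1-\|\tilde W\|^2_{\tilde h})^{(n+1)/2})$ in the Holmes–Thompson (HT) case; $\varrho',\varrho''$ are derivatives in $\mathfrak s$; $(\log\chi)'$ is the derivative of $\log\chi$ with respect to $\|\tilde W\|^2_{\tilde h}$. With $\mathcal F=\frac{\varrho(\mathfrak s)}{\chi}\sqrt{\det(h_{ij})}$ viewed as a function of $\tilde x$ and $z=(z^\alpha_i)$, the mean curvature form is defined by $\mathcal H_\gamma=\frac1{\mathcal F}\Big\{\frac{\partial\mathcal F}{\partial\tilde x^\gamma}-\frac{\partial^2\mathcal F}{\partial z^\gamma_i\partial z^\eta_j}\frac{\partial^2 f^\eta}{\partial x^i\partial x^j}-\frac{\partial^2\mathcal F}{\partial\tilde x^\eta\partial z^\gamma_i}\frac{\partial f^\eta}{\partial x^i}\Big\}$. *)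

theory Defs
  imports "HOL-Analysis.Analysis"
begin

(* Local-coordinate setting: M^n is an open set U in R^n (index type 'n),
   tilde M^{n+p} an open set V in R^{n+p} (index type 'm).  Vectors real^'n,
   real^'m; a matrix z = (z^alpha_i) is real^'n^'m with z$alpha$i. *)

definition pd :: "('a::real_normed_vector \<Rightarrow> real) \<Rightarrow> 'a \<Rightarrow> 'a \<Rightarrow> real" where
  "pd g v a = deriv (\<lambda>t. g (a + t *\<^sub>R v)) 0"

fun iter_pd :: "('a::real_normed_vector \<Rightarrow> real) \<Rightarrow> 'a list \<Rightarrow> 'a \<Rightarrow> real" where
  "iter_pd g [] = g"
| "iter_pd g (v # vs) = pd (iter_pd g vs) v"

definition smooth_on :: "('a::real_normed_vector) set \<Rightarrow> ('a \<Rightarrow> real) \<Rightarrow> bool" where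
  "smooth_on S g \<longleftrightarrow> open S \<and> (\<forall>vs. iter_pd g vs differentiable_on S)"

definition kd :: "'i \<Rightarrow> 'i \<Rightarrow> real" where
  "kd a b = (if a = b then 1 else 0)"

definition dx :: "(real^'k \<Rightarrow> real) \<Rightarrow> 'k::finite \<Rightarrow> real^'k \<Rightarrow> real" where
  "dx g k a = pd g (axis k 1) a"

definition christoffel :: "(real^'k \<Rightarrow> real^'k^'k) \<Rightarrow> real^'k \<Rightarrow> 'k::finite \<Rightarrow> 'k \<Rightarrow> 'k \<Rightarrow> real" where
  "christoffel g y a b c = (1/2) * (\<Sum>d\<in>UNIV. matrix_inv (g y) $ a $ d *
      (dx (\<lambda>u. g u $ d $ c) b y + dx (\<lambda>u. g u $ d $ b) c y - dx (\<lambda>u. g u $ b $ c) d y))"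

definition riemannian_on :: "(real^'k) set \<Rightarrow> (real^'k \<Rightarrow> real^'k^'k) \<Rightarrow> bool" where
  "riemannian_on V g \<longleftrightarrow> (\<forall>a b. smooth_on V (\<lambda>y. g y $ a $ b)) \<and>
     (\<forall>y\<in>V. (\<forall>a b. g y $ a $ b = g y $ b $ a) \<and>
        (\<forall>v. v \<noteq> 0 \<longrightarrow> (\<Sum>a\<in>UNIV. \<Sum>b\<in>UNIV. g y $ a $ b * v $ a * v $ b) > 0))"

definition nrm2 :: "(real^'k \<Rightarrow> real^'k^'k) \<Rightarrow> (real^'k \<Rightarrow> real^'k) \<Rightarrow> real^'k \<Rightarrow> real" where
  "nrm2 g W y = (\<Sum>a\<in>UNIV. \<Sum>b\<in>UNIV. g y $ a $ b * W y $ a * W y $ b)"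

definition lowW :: "(real^'k \<Rightarrow> real^'k^'k) \<Rightarrow> (real^'k \<Rightarrow> real^'k) \<Rightarrow> real^'k \<Rightarrow> 'k::finite \<Rightarrow> real" where
  "lowW g W y a = (\<Sum>b\<in>UNIV. g y $ a $ b * W y $ b)"

(* Killing vector field: Lie derivative of g along W vanishes *)
definition killing_on :: "(real^'k) set \<Rightarrow> (real^'k \<Rightarrow> real^'k^'k) \<Rightarrow> (real^'k \<Rightarrow> real^'k) \<Rightarrow> bool" where
  "killing_on V g W \<longleftrightarrow> (\<forall>y\<in>V. \<forall>a b.
     (\<Sum>d\<in>UNIV. W y $ d * dx (\<lambda>u. g u $ a $ b) d y
        + g y $ d $ b * dx (\<lambda>u. W u $ d) a y + g y $ a $ d * dx (\<lambda>u. W u $ d) b y) = 0)"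

definition covW :: "(real^'k \<Rightarrow> real^'k^'k) \<Rightarrow> (real^'k \<Rightarrow> real^'k) \<Rightarrow> real^'k \<Rightarrow> 'k::finite \<Rightarrow> 'k \<Rightarrow> real" where
  "covW g W y b e = dx (\<lambda>u. W u $ b) e y + (\<Sum>d\<in>UNIV. christoffel g y b e d * W y $ d)"

definition covWl :: "(real^'k \<Rightarrow> real^'k^'k) \<Rightarrow> (real^'k \<Rightarrow> real^'k) \<Rightarrow> real^'k \<Rightarrow> 'k::finite \<Rightarrow> 'k \<Rightarrow> real" where
  "covWl g W y a e = (\<Sum>b\<in>UNIV. g y $ a $ b * covW g W y b e)"

definition hmat :: "real^'m^'m \<Rightarrow> real^'n^'m \<Rightarrow> real^'n^'n" where
  "hmat G z = (\<chi> i j. \<Sum>a\<in>UNIV. \<Sum>b\<in>UNIV. G $ a $ b * z $ a $ i * z $ b $ j)"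

definition frak_s :: "(real^'m \<Rightarrow> real^'m^'m) \<Rightarrow> (real^'m \<Rightarrow> real^'m) \<Rightarrow> real^'m \<Rightarrow> real^'n^'m \<Rightarrow> real" where
  "frak_s g W y z = 1 - nrm2 g W y +
     (\<Sum>i\<in>UNIV. \<Sum>j\<in>UNIV. matrix_inv (hmat (g y) z) $ i $ j *
        (\<Sum>a\<in>UNIV. lowW g W y a * z $ a $ i) * (\<Sum>a\<in>UNIV. lowW g W y a * z $ a $ j))"

datatype volform = BH | HT

(* rho as function of s, chi as function of w = |W~|^2, n = dim M *)
definition rho :: "volform \<Rightarrow> nat \<Rightarrow> real \<Rightarrow> real" where
  "rho vt n s = (case vt of BH \<Rightarrow> s powr (- (real n / 2)) | HT \<Rightarrow> s powr (1/2))"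

definition chi :: "volform \<Rightarrow> nat \<Rightarrow> real \<Rightarrow> real" where
  "chi vt n w = (case vt of BH \<Rightarrow> 1 | HT \<Rightarrow> (1 - w) powr ((real n + 1) / 2))"

definition Fcal :: "volform \<Rightarrow> (real^'m \<Rightarrow> real^'m^'m) \<Rightarrow> (real^'m \<Rightarrow> real^'m) \<Rightarrow>
     (real^'m) \<times> (real^'n::finite^'m::finite) \<Rightarrow> real" where
  "Fcal vt g W q = rho vt CARD('n) (frak_s g W (fst q) (snd q)) / chi vt CARD('n) (nrm2 g W (fst q))
      * sqrt (det (hmat (g (fst q)) (snd q)))"

definition dirX :: "'m \<Rightarrow> (real^'m::finite) \<times> (real^'n::finite^'m)" where
  "dirX c = (axis c 1, 0)"
definition dirZ :: "'m \<Rightarrow> 'n \<Rightarrow> (real^'m::finite) \<times> (real^'n::finite^'m)" where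
  "dirZ c i = (0, axis c (axis i 1))"

definition Dfz :: "(real^'n \<Rightarrow> real^'m) \<Rightarrow> real^'n::finite \<Rightarrow> real^'n^'m::finite" where
  "Dfz f x = (\<chi> a i. dx (\<lambda>u. f u $ a) i x)"

definition d2f :: "(real^'n \<Rightarrow> real^'m) \<Rightarrow> real^'n::finite \<Rightarrow> 'm::finite \<Rightarrow> 'n \<Rightarrow> 'n \<Rightarrow> real" where
  "d2f f x a i j = dx (\<lambda>u. dx (\<lambda>v. f v $ a) j u) i x"

definition meancurv :: "volform \<Rightarrow> (real^'m \<Rightarrow> real^'m^'m) \<Rightarrow> (real^'m \<Rightarrow> real^'m) \<Rightarrow>
    (real^'n \<Rightarrow> real^'m) \<Rightarrow> real^'n::finite \<Rightarrow> 'm::finite \<Rightarrow> real" where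
  "meancurv vt g W f x c = (let F = Fcal vt g W; q = (f x, Dfz f x) in
     (1 / F q) * (pd F (dirX c) q
       - (\<Sum>i\<in>UNIV. \<Sum>j\<in>UNIV. \<Sum>e\<in>UNIV. pd (\<lambda>r. pd F (dirZ e j) r) (dirZ c i) q * d2f f x e i j)
       - (\<Sum>i\<in>UNIV. \<Sum>e\<in>UNIV. pd (\<lambda>r. pd F (dirZ c i) r) (dirX e) q * Dfz f x $ e $ i)))"

definition sff :: "(real^'m \<Rightarrow> real^'m^'m) \<Rightarrow> (real^'n \<Rightarrow> real^'m) \<Rightarrow> real^'n::finite \<Rightarrow> 'm::finite \<Rightarrow> 'n \<Rightarrow> 'n \<Rightarrow> real" where
  "sff g f x a i j = d2f f x a i j
     + (\<Sum>t\<in>UNIV. \<Sum>d\<in>UNIV. christoffel g (f x) a t d * Dfz f x $ t $ j * Dfz f x $ d $ i)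
     - (\<Sum>k\<in>UNIV. christoffel (\<lambda>u. hmat (g (f u)) (Dfz f u)) x k i j * Dfz f x $ a $ k)"

definition rhs :: "volform \<Rightarrow> (real^'m \<Rightarrow> real^'m^'m) \<Rightarrow> (real^'m \<Rightarrow> real^'m) \<Rightarrow>
    (real^'n \<Rightarrow> real^'m) \<Rightarrow> real^'n::finite \<Rightarrow> 'm::finite \<Rightarrow> real" where
  "rhs vt g W f x c = (let
      n = CARD('n); y = f x; z = Dfz f x; G = g y;
      hi = matrix_inv (hmat G z);
      s = frak_s g W y z;
      r0 = rho vt n s; r1 = deriv (rho vt n) s; r2 = deriv (deriv (rho vt n)) s;
      L = deriv (\<lambda>w. ln (chi vt n w)) (nrm2 g W y);
      Wu = (\<lambda>a. W y $ a); Wl = lowW g W y; Wc = covWl g W y;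
      A = (\<lambda>i a. \<Sum>j\<in>UNIV. hi $ i $ j * z $ a $ j);
      B = (\<lambda>a b. \<Sum>i\<in>UNIV. \<Sum>j\<in>UNIV. hi $ i $ j * z $ a $ i * z $ b $ j);
      Bm = (\<lambda>a b. \<Sum>d\<in>UNIV. B a d * G $ d $ b);
      P = (\<lambda>a b. kd a b - Bm a b);
      Q = (\<lambda>u v e. 2 * u * (\<Sum>d\<in>UNIV. \<Sum>t\<in>UNIV. B e d * Wl d * Wl t * P t c) - v * P e c);
      K = (\<lambda>u v. \<Sum>e\<in>UNIV. \<Sum>a\<in>UNIV. Q u v e * Wc a e * Wu a);
      T = (\<lambda>a i j. hi $ i $ j * (2 * r1 * Wl a * (\<Sum>b\<in>UNIV. Wl b * P b c) + r0 * G $ c $ a)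
            + 2 * (\<Sum>d\<in>UNIV. \<Sum>t\<in>UNIV. Wl d * Wl t * A i d * A j t)
                * (2 * r2 * Wl a * (\<Sum>b\<in>UNIV. Wl b * P b c) - r1 * G $ c $ a))
    in 2 * L / r0 * K r1 r0
       - (1 / r0) * (4 * r1 * (\<Sum>e\<in>UNIV. \<Sum>b\<in>UNIV. \<Sum>a\<in>UNIV. B e b * Wc a e * Wl b * P a c)
                     - 2 * K r2 r1)
       - (1 / r0) * (\<Sum>i\<in>UNIV. \<Sum>j\<in>UNIV. \<Sum>a\<in>UNIV. T a i j * sff g f x a i j))"

end

theory Submission
  imports Defs
begin

text \<open>
  The integrand $\mathcal F$ depends on the ambient metric G, the covector p with components
  $\tilde W_\alpha$, the number $w = \|\tilde W\|^2$ and the matrix z.  By Schwarz's theorem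
  $\mathcal H_\gamma$ is its Euler-Lagrange expression
  $\partial_\gamma \mathcal F - \frac{d}{dx^i}\frac{\partial\mathcal F}{\partial z^\gamma_i}$
  divided by $\mathcal F$.  The integrand is invariant under the simultaneous action of GL(m) on
  (G, p, z); infinitesimally, this turns coordinate derivatives in the ambient space into covariant
  ones, and the ambient Christoffel symbols are absorbed into the second fundamental form $\tau$.
  The Christoffel symbols of the induced metric contribute nothing, because a tangential variation
  of z is a reparametrisation.  What remains is the response of the momentum
  $\partial\mathcal F/\partial z^\gamma_i$ to the covariant derivative of $\tilde W$, evaluated with
  the skewness of $\nabla\tilde W$ for a Killing field, and to $\tau$, evaluated with the symmetry and
  normality of $\tau$ (Gauss formula).
\<close>

declare transpose_matrix_vector [simp del] vector_transpose_matrix [simp del]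

subsection \<open>Matrix calculus\<close>

interpretation matrix_mult: bounded_bilinear "(**) :: real^'n^'m \<Rightarrow> real^'k^'n \<Rightarrow> real^'k^'m"
  by (subst bilinear_conv_bounded_bilinear[symmetric])
    (auto simp: bilinear_def linear_iff matrix_matrix_mult_def vec_eq_iff sum.distrib
      sum_distrib_left algebra_simps)

interpretation matrix_vector_mult: bounded_bilinear "(*v) :: real^'n^'m \<Rightarrow> real^'n \<Rightarrow> real^'m"
  by (subst bilinear_conv_bounded_bilinear[symmetric])
    (auto simp: bilinear_def linear_iff matrix_vector_mult_def vec_eq_iff sum.distrib
      sum_distrib_left algebra_simps)

lemma bounded_linear_transpose: "bounded_linear (transpose :: real^'n^'m \<Rightarrow> real^'m^'n)"
  by (subst linear_conv_bounded_linear[symmetric]) (auto simp: linear_iff transpose_def vec_eq_iff)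

lemma bounded_linear_trace: "bounded_linear (trace :: real^'n^'n \<Rightarrow> real)"
  by (subst linear_conv_bounded_linear[symmetric])
    (auto simp: linear_iff trace_def sum.distrib sum_distrib_left)

lemmas linear_transpose = bounded_linear.linear[OF bounded_linear_transpose]
lemmas linear_trace = bounded_linear.linear[OF bounded_linear_trace]

lemmas matrix_has_derivative [derivative_intros] =
  matrix_mult.FDERIV matrix_vector_mult.FDERIV
  bounded_linear.has_derivative[OF bounded_linear_transpose]
  bounded_linear.has_derivative[OF bounded_linear_trace]
  bounded_linear.has_derivative[OF bounded_linear_vec_nth]

lemmas matrix_normalize =
  matrix_mult.add_left matrix_mult.add_right matrix_mult.diff_left matrix_mult.diff_right
  matrix_mult.minus_left matrix_mult.minus_right matrix_mult.zero_left matrix_mult.zero_right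
  matrix_mult.scaleR_left matrix_mult.scaleR_right
  matrix_vector_mult.add_left matrix_vector_mult.add_right
  matrix_vector_mult.diff_left matrix_vector_mult.diff_right
  matrix_vector_mult.minus_left matrix_vector_mult.minus_right
  matrix_vector_mult.zero_left matrix_vector_mult.zero_right
  matrix_vector_mult.scaleR_left matrix_vector_mult.scaleR_right
  linear_add[OF linear_transpose] linear_diff[OF linear_transpose] linear_neg[OF linear_transpose]
  linear_0[OF linear_transpose] linear_scale[OF linear_transpose]
  linear_add[OF linear_trace] linear_diff[OF linear_trace] linear_neg[OF linear_trace]
  linear_0[OF linear_trace] linear_scale[OF linear_trace]
  matrix_transpose_mul matrix_mul_assoc[symmetric] matrix_vector_mul_assoc[symmetric]

lemma inner_matrix_vector_transpose: "(M *v x) \<bullet> y = x \<bullet> (transpose M *v y)" for M :: "real^'n^'m"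
  by (simp add: dot_lmul_matrix[symmetric] transpose_matrix_vector inner_commute)

lemma trace_transpose: "trace (transpose M) = trace M"
  by (simp add: trace_def transpose_def)

lemma matrix_eqI_inner:
  fixes M N :: "real^'n^'m"
  assumes "\<And>x y. x \<bullet> (M *v y) = x \<bullet> (N *v y)"
  shows "M = N"
  using assms by (metis matrix_eq vector_eq_ldot)

lemma has_derivative_vec_componentwise:
  fixes f :: "'a::real_normed_vector \<Rightarrow> 'b::euclidean_space^'n"
  assumes "\<And>i. ((\<lambda>x. f x $ i) has_derivative (\<lambda>h. f' h $ i)) (at x within X)"
  shows "(f has_derivative f') (at x within X)"
  unfolding has_derivative_componentwise_within[of f]
  by (auto simp: Basis_vec_def inner_axis intro: has_derivative_inner_left assms)

lemma differentiable_vec_componentwise: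
  fixes f :: "'a::real_normed_vector \<Rightarrow> 'b::euclidean_space^'n"
  assumes "\<And>i. (\<lambda>x. f x $ i) differentiable (at x within X)"
  shows "f differentiable (at x within X)"
proof -
  obtain D where "\<And>i. ((\<lambda>x. f x $ i) has_derivative D i) (at x within X)"
    using assms unfolding differentiable_def by metis
  then have "(f has_derivative (\<lambda>h. \<chi> i. D i h)) (at x within X)"
    by (intro has_derivative_vec_componentwise) simp
  then show ?thesis by (rule differentiableI)
qed

subsection \<open>Derivative of the determinant and of the inverse\<close>

lemma differentiable_det:
  fixes M :: "'a::real_normed_vector \<Rightarrow> real^'n^'n"
  assumes "M differentiable (at x within X)"
  shows "(\<lambda>x. det (M x)) differentiable (at x within X)"
proof -
  obtain D where D: "(M has_derivative D) (at x within X)"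
    using assms by (auto simp: differentiable_def)
  have "(\<lambda>x. \<Prod>i\<in>UNIV. M x $ i $ p i) differentiable (at x within X)" for p
    by (rule differentiableI) (auto intro!: derivative_eq_intros D)
  then show ?thesis
    unfolding det_def by (auto intro!: differentiable_sum differentiable_mult)
qed

lemma prod_mat_1_permutation:
  assumes "p permutes (UNIV :: 'n::finite set)" "p \<noteq> id"
  shows "(\<Prod>j\<in>UNIV - {i}. (mat 1 :: real^'n^'n) $ j $ p j) = 0"
proof -
  obtain k where k: "p k \<noteq> k" using assms(2) by (metis eq_id_iff)
  then have "p (p k) \<noteq> p k"
    using permutes_inj[OF assms(1)] by (simp add: inj_eq)
  with k obtain j where "j \<noteq> i" "p j \<noteq> j" by metis
  then have "j \<in> UNIV - {i}" "(mat 1 :: real^'n^'n) $ j $ p j = 0" by (auto simp: mat_def)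
  then show ?thesis by (auto intro!: prod_zero)
qed

lemma has_derivative_det_mat_1: "(det has_derivative trace) (at (mat 1 :: real^'n^'n))"
proof -
  let ?minor = "\<lambda>p i. \<Prod>j\<in>UNIV - {i}. (mat 1 :: real^'n^'n) $ j $ p j"
  have "(\<Sum>i\<in>UNIV. H $ i $ p i * ?minor p i) = (if p = id then trace H else 0)"
    if "p permutes UNIV" for p and H :: "real^'n^'n"
    by (cases "p = id") (simp_all add: prod_mat_1_permutation[OF that], simp add: trace_def mat_def)
  then have "(\<Sum>p | p permutes UNIV. of_int (sign p) * (\<Sum>i\<in>UNIV. H $ i $ p i * ?minor p i)) =
      (\<Sum>p | p permutes (UNIV :: 'n set). if p = id then trace H else 0)" for H :: "real^'n^'n"
    by (intro sum.cong) (auto simp: sign_id)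
  then have "(\<Sum>p | p permutes UNIV. of_int (sign p) * (\<Sum>i\<in>UNIV. H $ i $ p i * ?minor p i)) =
      trace H" for H :: "real^'n^'n"
    by (simp add: sum.delta' finite_permutations permutes_id)
  then show ?thesis
    unfolding det_def by (auto intro!: derivative_eq_intros)
qed

lemma
  assumes "invertible M"
  shows matrix_inv_right: "M ** matrix_inv M = mat 1"
    and matrix_inv_left: "matrix_inv M ** M = mat 1"
  using someI_ex[OF assms[unfolded invertible_def]] unfolding matrix_inv_def by auto

lemma transpose_matrix_inv:
  fixes M :: "real^'n^'n"
  assumes "invertible M" "transpose M = M"
  shows "transpose (matrix_inv M) = matrix_inv M"
proof -
  have "M ** transpose (matrix_inv M) = mat 1"
    using matrix_inv_left[OF assms(1)] assms(2) by (metis matrix_transpose_mul transpose_mat)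
  then show ?thesis
    by (metis assms(1) matrix_inv_left matrix_mul_assoc matrix_mul_lid matrix_mul_rid)
qed

lemma has_derivative_det [derivative_intros]:
  fixes M :: "'a::real_normed_vector \<Rightarrow> real^'n^'n"
  assumes M: "(M has_derivative M') (at x within X)" and inv: "invertible (M x)"
  shows "((\<lambda>x. det (M x)) has_derivative (\<lambda>h. det (M x) * trace (matrix_inv (M x) ** M' h)))
    (at x within X)"
proof -
  let ?I = "matrix_inv (M x)"
  have "((\<lambda>y. det (?I ** M y)) has_derivative (\<lambda>h. trace (?I ** M' h))) (at x within X)"
  proof (rule has_derivative_compose[of "\<lambda>y. ?I ** M y" "\<lambda>h. ?I ** M' h" x X det trace])
    show "((\<lambda>y. ?I ** M y) has_derivative (\<lambda>h. ?I ** M' h)) (at x within X)"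
      by (auto intro!: derivative_eq_intros M)
    show "(det has_derivative trace) (at (?I ** M x))"
      unfolding matrix_inv_left[OF inv] by (rule has_derivative_det_mat_1)
  qed
  then have "((\<lambda>y. det (M x) * det (?I ** M y)) has_derivative (\<lambda>h. det (M x) * trace (?I ** M' h)))
      (at x within X)"
    by (rule has_derivative_mult_right)
  moreover have "det (M x) * det (?I ** M y) = det (M y)" for y
    by (metis det_mul inv matrix_inv_right matrix_mul_assoc matrix_mul_lid)
  ultimately show ?thesis by simp
qed

lemma matrix_inv_cramer:
  fixes M :: "real^'n^'n"
  assumes "invertible M"
  shows "matrix_inv M $ k $ l = det (\<chi> i j. if j = k then axis l 1 $ i else M $ i $ j) / det M"
proof -
  have "M *v (matrix_inv M *v axis l 1) = axis l 1"
    using assms by (simp add: matrix_vector_mul_assoc matrix_inv_right)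
  moreover have "det M \<noteq> 0"
    using assms invertible_det_nz by blast
  ultimately have "matrix_inv M *v axis l 1 =
      (\<chi> k. det (\<chi> i j. if j = k then axis l 1 $ i else M $ i $ j) / det M)"
    by (simp add: cramer)
  then have "(matrix_inv M *v axis l 1) $ k =
      det (\<chi> i j. if j = k then axis l 1 $ i else M $ i $ j) / det M"
    by simp
  then show ?thesis
    by (simp add: matrix_vector_mult_basis column_def)
qed

lemma open_invertible: "open {M :: real^'n^'n. invertible M}"
proof -
  have "continuous_on UNIV (det :: real^'n^'n \<Rightarrow> real)"
    by (intro differentiable_imp_continuous_on)
      (auto simp: differentiable_on_def intro: differentiable_det)
  then show ?thesis
    unfolding invertible_det_nz by (intro open_Collect_neq) (auto intro: continuous_intros)
qed

lemma differentiable_matrix_inv: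
  fixes M :: "real^'n^'n"
  assumes inv: "invertible M"
  shows "matrix_inv differentiable (at M)"
proof -
  let ?M = "\<lambda>k l M. (\<chi> i j. if j = k then axis l 1 $ i else M $ i $ j) :: real^'n^'n"
  let ?J = "\<lambda>M. (\<chi> k l. det (?M k l M) / det M) :: real^'n^'n"
  have entry: "(\<lambda>M :: real^'n^'n. M $ i $ j) differentiable (at M)" for i j
    by (intro bounded_linear_imp_differentiable bounded_linear_vec_nth
        bounded_linear_compose[OF bounded_linear_vec_nth])
  have "?M k l differentiable (at M)" for k l
  proof (intro differentiable_vec_componentwise)
    show "(\<lambda>M. ?M k l M $ i $ j) differentiable (at M)" for i j
      by (cases "j = k") (simp_all add: entry)
  qed
  then have "?J differentiable (at M)"
    using inv unfolding invertible_det_nz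
    by (intro differentiable_vec_componentwise) (simp add: differentiable_divide differentiable_det)
  then obtain D where "(?J has_derivative D) (at M)" by (auto simp: differentiable_def)
  then have "(matrix_inv has_derivative D) (at M)"
    by (rule has_derivative_transform_within_open[OF _ open_invertible])
      (use inv in \<open>auto simp: vec_eq_iff matrix_inv_cramer\<close>)
  then show ?thesis by (rule differentiableI)
qed

lemma has_derivative_matrix_inv [derivative_intros]:
  fixes M :: "'a::real_normed_vector \<Rightarrow> real^'n^'n"
  assumes M: "(M has_derivative M') (at x within X)" and inv: "invertible (M x)"
  shows "((\<lambda>x. matrix_inv (M x)) has_derivative
    (\<lambda>h. - (matrix_inv (M x) ** M' h ** matrix_inv (M x)))) (at x within X)"
proof -
  let ?I = "matrix_inv (M x)"
  obtain D where D: "(matrix_inv has_derivative D) (at (M x))"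
    using differentiable_matrix_inv[OF inv] by (auto simp: differentiable_def)
  have "((\<lambda>N. matrix_inv N ** N) has_derivative (\<lambda>H. ?I ** H + D H ** M x)) (at (M x))"
    by (rule matrix_mult.FDERIV[OF D has_derivative_ident])
  moreover have "((\<lambda>N. matrix_inv N ** N) has_derivative (\<lambda>H. 0)) (at (M x))"
    by (rule has_derivative_transform_within_open[
          OF has_derivative_const[of "mat 1"] open_invertible])
      (use inv in \<open>auto simp: matrix_inv_left\<close>)
  ultimately have "(\<lambda>H. ?I ** H + D H ** M x) = (\<lambda>H. 0)"
    by (rule has_derivative_unique)
  then have D_mult: "D H ** M x = - (?I ** H)" for H
    by (metis add_eq_0_iff)
  have "D H = - (?I ** H ** ?I)" for H
  proof -
    have "D H = D H ** M x ** ?I"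
      by (simp add: matrix_mul_assoc[symmetric] matrix_inv_right inv)
    then show ?thesis by (simp add: D_mult matrix_mult.minus_left)
  qed
  then have "D = (\<lambda>H. - (?I ** H ** ?I))" by blast
  with has_derivative_compose[OF M D] show ?thesis by simp
qed

subsection \<open>Injective frames in an inner product space\<close>

definition positive_definite :: "real^'n^'n \<Rightarrow> bool" where
  "positive_definite G \<longleftrightarrow> transpose G = G \<and> (\<forall>x. x \<noteq> 0 \<longrightarrow> x \<bullet> (G *v x) > 0)"

lemma det_positive_definite:
  fixes G :: "real^'n^'n"
  assumes "positive_definite G"
  shows "det G > 0"
proof (rule ccontr)
  assume neg: "\<not> det G > 0"
  define M where "M t = (1 - t) *\<^sub>R mat 1 + t *\<^sub>R G" for t :: real
  have "\<exists>t\<ge>0. t \<le> 1 \<and> det (M t) = 0"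
  proof (rule IVT2')
    show "det (M 1) \<le> 0" "0 \<le> det (M 0)" using neg by (simp_all add: M_def)
    have "M differentiable (at t)" for t
      unfolding M_def by (intro differentiableI) (auto intro!: derivative_eq_intros)
    then show "continuous_on {0..1} (\<lambda>t. det (M t))"
      by (intro differentiable_imp_continuous_on)
        (auto simp: differentiable_on_def intro: differentiable_det differentiable_at_withinI)
  qed simp
  then obtain t where t: "0 \<le> t" "t \<le> 1" "det (M t) = 0" by blast
  then have "\<not> invertible (M t)" by (simp add: invertible_det_nz)
  then obtain x where x: "M t *v x = 0" "x \<noteq> 0"
    using matrix_left_invertible_ker[of "M t"] invertible_left_inverse[of "M t"] by blast
  have "x \<bullet> (M t *v x) = (1 - t) * (x \<bullet> x) + t * (x \<bullet> (G *v x))"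
    by (simp add: M_def matrix_normalize inner_add_right)
  moreover have "\<dots> > 0"
    using t assms x(2)
    by (cases "t = 0") (auto simp: positive_definite_def intro!: add_nonneg_pos)
  ultimately show False using x(1) by simp
qed

lemma invertible_positive_definite: "positive_definite G \<Longrightarrow> invertible G"
  using det_positive_definite invertible_det_nz by fastforce

lemma positive_definite_mat_1: "positive_definite (mat 1)"
  by (simp add: positive_definite_def)

lemma hmat_eq: "hmat G z = transpose z ** G ** z"
proof -
  have "(\<Sum>a\<in>UNIV. \<Sum>b\<in>UNIV. G $ a $ b * z $ a $ i * z $ b $ j) =
    (\<Sum>b\<in>UNIV. (\<Sum>a\<in>UNIV. z $ a $ i * G $ a $ b) * z $ b $ j)" for i j
    by (subst sum.swap) (simp add: sum_distrib_left mult_ac)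
  then show ?thesis
    by (simp add: hmat_def matrix_matrix_mult_def transpose_def vec_eq_iff)
qed

lemma inner_hmat: "x \<bullet> (hmat G z *v y) = (z *v x) \<bullet> (G *v (z *v y))"
  by (simp add: hmat_eq inner_matrix_vector_transpose matrix_normalize)

lemma positive_definite_hmat:
  assumes "positive_definite G" "inj ((*v) z)"
  shows "positive_definite (hmat G z)"
proof -
  have "z *v x \<noteq> 0" if "x \<noteq> 0" for x
    using injD[OF assms(2), of x 0] that by auto
  then show ?thesis
    using assms(1) by (simp add: positive_definite_def inner_hmat)
      (simp add: hmat_eq matrix_normalize)
qed

lemma inj_matrix_iff_det_gram:
  fixes z :: "real^'n^'m"
  shows "inj ((*v) z) \<longleftrightarrow> det (hmat (mat 1) z) \<noteq> 0"
proof
  assume "inj ((*v) z)"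
  then show "det (hmat (mat 1) z) \<noteq> 0"
    using det_positive_definite[OF positive_definite_hmat[OF positive_definite_mat_1]] by force
next
  assume "det (hmat (mat 1) z) \<noteq> 0"
  then have "inj ((*v) (hmat (mat 1) z))"
    by (intro inj_matrix_vector_mult) (simp add: invertible_det_nz)
  then have "inj ((*v) (transpose z) \<circ> (*v) z)"
    by (simp add: hmat_eq comp_def matrix_vector_mul_assoc)
  then show "inj ((*v) z)" by (rule inj_on_imageI2)
qed

lemma open_inj_matrix: "open {z :: real^'n^'m. inj ((*v) z)}"
proof -
  have "hmat (mat 1) differentiable (at z)" for z :: "real^'n^'m"
    unfolding hmat_eq by (rule differentiableI) (auto intro!: derivative_eq_intros)
  then have "continuous_on UNIV (\<lambda>z :: real^'n^'m. det (hmat (mat 1) z))"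
    by (intro differentiable_imp_continuous_on)
      (auto simp: differentiable_on_def intro: differentiable_det)
  then show ?thesis
    unfolding inj_matrix_iff_det_gram by (intro open_Collect_neq) (auto intro: continuous_intros)
qed

text \<open>
  In the notation of the statement, \<open>cometric\<close> is $(h^{ij})$, \<open>Amat\<close> is $(A^{i\alpha})$,
  \<open>Bmat\<close> is $(B^{\alpha\beta})$ and \<open>normal_proj\<close> is $(\delta^\alpha_\beta - B^\alpha_\beta)$.
  For the covector p with components $\tilde W_\alpha$, \<open>tangent_part\<close> is
  $A^{i\alpha}\tilde W_\alpha$ and \<open>conormal_part\<close> is
  $\tilde W_\tau(\delta^\tau_\gamma - B^\tau_\gamma)$.
\<close>

definition cometric :: "real^'m^'m \<Rightarrow> real^'n^'m \<Rightarrow> real^'n^'n" where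
  "cometric G z = matrix_inv (hmat G z)"

definition Amat :: "real^'m^'m \<Rightarrow> real^'n^'m \<Rightarrow> real^'m^'n" where
  "Amat G z = cometric G z ** transpose z"

definition Bmat :: "real^'m^'m \<Rightarrow> real^'n^'m \<Rightarrow> real^'m^'m" where
  "Bmat G z = z ** Amat G z"

definition tangent_coord :: "real^'m^'m \<Rightarrow> real^'n^'m \<Rightarrow> real^'m^'n" where
  "tangent_coord G z = Amat G z ** G"

definition normal_proj :: "real^'m^'m \<Rightarrow> real^'n^'m \<Rightarrow> real^'m^'m" where
  "normal_proj G z = mat 1 - z ** tangent_coord G z"

definition tangent_part :: "real^'m^'m \<Rightarrow> real^'n^'m \<Rightarrow> real^'m \<Rightarrow> real^'n" where
  "tangent_part G z p = Amat G z *v p"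

definition conormal_part :: "real^'m^'m \<Rightarrow> real^'n^'m \<Rightarrow> real^'m \<Rightarrow> real^'m" where
  "conormal_part G z p = transpose (normal_proj G z) *v p"

locale frame =
  fixes G :: "real^'m^'m" and z :: "real^'n^'m"
  assumes positive: "positive_definite G" and inj: "inj ((*v) z)"
begin

lemma transpose_metric: "transpose G = G"
  using positive by (simp add: positive_definite_def)

lemma inner_metric: "x \<bullet> (G *v y) = (G *v x) \<bullet> y"
  by (simp add: inner_matrix_vector_transpose transpose_metric)

lemma positive_definite_induced: "positive_definite (hmat G z)"
  by (rule positive_definite_hmat[OF positive inj])

lemma det_induced: "det (hmat G z) > 0"
  by (rule det_positive_definite[OF positive_definite_induced])

lemma invertible_induced: "invertible (hmat G z)"
  by (rule invertible_positive_definite[OF positive_definite_induced])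

lemma transpose_cometric: "transpose (cometric G z) = cometric G z"
  using positive_definite_induced
  by (simp add: cometric_def transpose_matrix_inv[OF invertible_induced] positive_definite_def)

lemma transpose_Amat: "transpose (Amat G z) = z ** cometric G z"
  by (simp add: Amat_def matrix_transpose_mul transpose_cometric)

lemma transpose_tangent_coord: "transpose (tangent_coord G z) = G ** (z ** cometric G z)"
  by (simp add: tangent_coord_def matrix_transpose_mul transpose_Amat transpose_metric)

lemma transpose_normal_proj: "transpose (normal_proj G z) = mat 1 - G ** Bmat G z"
  by (simp add: normal_proj_def matrix_normalize transpose_tangent_coord Bmat_def Amat_def)

lemma tangent_coord_frame: "tangent_coord G z ** z = mat 1"
  using matrix_inv_left[OF invertible_induced]
  by (simp add: tangent_coord_def Amat_def cometric_def hmat_eq matrix_mul_assoc)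

lemma tangent_coord_frame_vec: "tangent_coord G z *v (z *v x) = x"
  by (simp add: tangent_coord_frame matrix_vector_mul_assoc)

lemma normal_proj_frame: "normal_proj G z ** z = 0"
  by (simp add: normal_proj_def matrix_normalize tangent_coord_frame)

lemma transpose_frame_conormal_part: "transpose z *v conormal_part G z p = 0"
  using arg_cong[OF normal_proj_frame, of transpose]
  by (simp add: conormal_part_def matrix_vector_mul_assoc matrix_transpose_mul)
    (simp add: matrix_normalize)

lemma conormal_part_eq: "conormal_part G z p = p - G *v (z *v tangent_part G z p)"
  by (simp add: conormal_part_def transpose_normal_proj matrix_normalize tangent_part_def Bmat_def)

lemma hmat_tangent_part: "hmat G z *v tangent_part G z p = transpose z *v p"
  using matrix_inv_right[OF invertible_induced]
  by (simp add: tangent_part_def Amat_def cometric_def matrix_vector_mul_assoc matrix_mul_assoc)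

lemma inner_tangent_part_nonneg: "p \<bullet> (z *v tangent_part G z p) \<ge> 0"
proof -
  let ?u = "tangent_part G z p"
  have "p \<bullet> (z *v ?u) = ?u \<bullet> (hmat G z *v ?u)"
    by (simp add: hmat_tangent_part inner_commute[of p] inner_matrix_vector_transpose)
  then show ?thesis
    using positive_definite_induced
    by (cases "?u = 0") (auto simp: positive_definite_def less_imp_le)
qed

end

subsection \<open>Variation of the integrand\<close>

definition navigation_s :: "real^'m^'m \<Rightarrow> real^'n^'m \<Rightarrow> real^'m \<Rightarrow> real \<Rightarrow> real" where
  "navigation_s G z p w = 1 - w + p \<bullet> (z *v tangent_part G z p)"

definition vol_density :: "(real \<Rightarrow> real) \<Rightarrow> real^'m^'m \<Rightarrow> real^'n^'m \<Rightarrow> real \<Rightarrow> real" where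
  "vol_density c G z w = sqrt (det (hmat G z)) / c w"

text \<open>
  The functions \<open>var_\<dots>\<close> are the velocities of the named quantities when (G, p, w, z) moves with
  velocity (S, q, \<omega>, Z); \<open>var_vol\<close> is the velocity of $\log\sqrt{\det h}$.  With the common factor
  $\sqrt{\det h}/\chi(w)$ removed, \<open>var_integrand\<close> is the velocity of the integrand
  $\varrho(\mathfrak s)\sqrt{\det h}/\chi(w)$, \<open>momentum\<close> its derivative in the direction Y of z, and
  \<open>var_momentum\<close> the velocity of that derivative.  The numbers r0, r1, r2, L stand for
  $\varrho, \varrho', \varrho'', (\log\chi)'$.
\<close>

definition var_tangent_coord ::
    "real^'m^'m \<Rightarrow> real^'n^'m \<Rightarrow> real^'m^'m \<Rightarrow> real^'n^'m \<Rightarrow> real^'m^'n" where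
  "var_tangent_coord G z S Z = cometric G z ** (transpose Z ** (transpose (normal_proj G z) ** G))
     + Amat G z ** (S ** normal_proj G z) - tangent_coord G z ** (Z ** tangent_coord G z)"

definition var_tangent_part ::
    "real^'m^'m \<Rightarrow> real^'n^'m \<Rightarrow> real^'m \<Rightarrow> real^'m^'m \<Rightarrow> real^'m \<Rightarrow> real^'n^'m \<Rightarrow> real^'n" where
  "var_tangent_part G z p S q Z = cometric G z *v (transpose Z *v conormal_part G z p)
     + Amat G z *v (q - S *v (z *v tangent_part G z p))
     - tangent_coord G z *v (Z *v tangent_part G z p)"

definition var_conormal_part ::
    "real^'m^'m \<Rightarrow> real^'n^'m \<Rightarrow> real^'m \<Rightarrow> real^'m^'m \<Rightarrow> real^'m \<Rightarrow> real^'n^'m \<Rightarrow> real^'m" where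
  "var_conormal_part G z p S q Z =
     transpose (normal_proj G z) *v (q - transpose S *v (z *v tangent_part G z p))
     - transpose (tangent_coord G z) *v (transpose Z *v conormal_part G z p)
     - G *v (normal_proj G z *v (Z *v tangent_part G z p))"

definition var_s ::
    "real^'m^'m \<Rightarrow> real^'n^'m \<Rightarrow> real^'m \<Rightarrow> real^'m^'m \<Rightarrow> real^'m \<Rightarrow> real \<Rightarrow> real^'n^'m \<Rightarrow> real" where
  "var_s G z p S q \<omega> Z = - \<omega> + 2 * (q \<bullet> (z *v tangent_part G z p))
     - (z *v tangent_part G z p) \<bullet> (S *v (z *v tangent_part G z p))
     + 2 * (conormal_part G z p \<bullet> (Z *v tangent_part G z p))"

definition var_vol :: "real^'m^'m \<Rightarrow> real^'n^'m \<Rightarrow> real^'m^'m \<Rightarrow> real^'n^'m \<Rightarrow> real" where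
  "var_vol G z S Z = trace (tangent_coord G z ** Z) + trace (Amat G z ** (S ** z)) / 2"

definition var_integrand ::
    "real \<Rightarrow> real \<Rightarrow> real \<Rightarrow> real^'m^'m \<Rightarrow> real^'n^'m \<Rightarrow> real^'m \<Rightarrow>
      (real^'m^'m) \<times> (real^'m) \<times> real \<times> (real^'n^'m) \<Rightarrow> real" where
  "var_integrand r0 r1 L G z p =
     (\<lambda>(S, q, \<omega>, Z). (var_vol G z S Z - L * \<omega>) * r0 + r1 * var_s G z p S q \<omega> Z)"

definition momentum ::
    "real \<Rightarrow> real \<Rightarrow> real^'m^'m \<Rightarrow> real^'n^'m \<Rightarrow> real^'m \<Rightarrow> real^'n^'m \<Rightarrow> real" where
  "momentum r0 r1 G z p Y = 2 * r1 * (conormal_part G z p \<bullet> (Y *v tangent_part G z p))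
     + r0 * trace (tangent_coord G z ** Y)"

definition var_momentum ::
    "real \<Rightarrow> real \<Rightarrow> real \<Rightarrow> real \<Rightarrow> real^'m^'m \<Rightarrow> real^'n^'m \<Rightarrow> real^'m \<Rightarrow>
      (real^'m^'m) \<times> (real^'m) \<times> real \<times> (real^'n^'m) \<Rightarrow> real^'n^'m \<Rightarrow> real" where
  "var_momentum r0 r1 r2 L G z p = (\<lambda>(S, q, \<omega>, Z) Y.
     (var_vol G z S Z - L * \<omega>) * momentum r0 r1 G z p Y
     + var_s G z p S q \<omega> Z * momentum r1 r2 G z p Y
     + 2 * r1 * (var_conormal_part G z p S q Z \<bullet> (Y *v tangent_part G z p)
       + conormal_part G z p \<bullet> (Y *v var_tangent_part G z p S q Z))
     + r0 * trace (var_tangent_coord G z S Z ** Y))"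

lemma linear_momentum: "linear (momentum r0 r1 G z p)"
  unfolding momentum_def linear_iff
  by (simp add: matrix_normalize inner_simps algebra_simps)

lemma var_integrand_frame: "var_integrand r0 r1 L G z p (0, 0, 0, Y) = momentum r0 r1 G z p Y"
  by (simp add: var_integrand_def momentum_def var_vol_def var_s_def matrix_normalize)

lemma linear_var_integrand: "linear (var_integrand r0 r1 L G z p)"
  by (simp add: linear_iff var_integrand_def var_vol_def var_s_def matrix_normalize inner_simps
      algebra_simps add_divide_distrib split_beta)

lemma linear_var_momentum: "linear (\<lambda>\<delta>. var_momentum r0 r1 r2 L G z p \<delta> Y)"
  by (simp add: linear_iff var_momentum_def var_vol_def var_s_def var_conormal_part_def
      var_tangent_part_def var_tangent_coord_def matrix_normalize inner_simps
      algebra_simps add_divide_distrib split_beta)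

locale variation =
  fixes G :: "'a::real_normed_vector \<Rightarrow> real^'m^'m" and z :: "'a \<Rightarrow> real^'n^'m"
    and p :: "'a \<Rightarrow> real^'m" and w :: "'a \<Rightarrow> real" and G' z' p' w' x
  assumes G': "(G has_derivative G') (at x)" and z': "(z has_derivative z') (at x)"
    and p': "(p has_derivative p') (at x)" and w': "(w has_derivative w') (at x)"
    and frame: "frame (G x) (z x)"
begin

sublocale frame "G x" "z x" by (rule frame)

definition var_metric :: "'a \<Rightarrow> real^'n^'n" where
  "var_metric h = transpose (z' h) ** (G x ** z x) + transpose (z x) ** (G' h ** z x)
     + transpose (z x) ** (G x ** z' h)"

lemma hmat_has_derivative: "((\<lambda>y. hmat (G y) (z y)) has_derivative var_metric) (at x)"
  unfolding hmat_eq
  by (auto intro!: derivative_eq_intros G' z' simp: var_metric_def matrix_normalize)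

lemma cometric_has_derivative:
  "((\<lambda>y. cometric (G y) (z y)) has_derivative
     (\<lambda>h. - (cometric (G x) (z x) ** var_metric h ** cometric (G x) (z x)))) (at x)"
  unfolding cometric_def
  by (rule has_derivative_matrix_inv[OF hmat_has_derivative invertible_induced])

lemma Amat_has_derivative:
  "((\<lambda>y. Amat (G y) (z y)) has_derivative (\<lambda>h.
     cometric (G x) (z x) ** transpose (z' h)
     - cometric (G x) (z x) ** var_metric h ** cometric (G x) (z x) ** transpose (z x))) (at x)"
  unfolding Amat_def
  by (auto intro!: derivative_eq_intros cometric_has_derivative z' simp: matrix_normalize)

lemma tangent_coord_has_derivative:
  "((\<lambda>y. tangent_coord (G y) (z y)) has_derivative
     (\<lambda>h. var_tangent_coord (G x) (z x) (G' h) (z' h))) (at x)"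
  unfolding tangent_coord_def
  by (rule has_derivative_eq_rhs[OF matrix_mult.FDERIV[OF Amat_has_derivative G']])
    (simp add: fun_eq_iff var_tangent_coord_def var_metric_def transpose_normal_proj Bmat_def
      normal_proj_def Amat_def tangent_coord_def transpose_cometric transpose_metric
      matrix_normalize algebra_simps)

lemma tangent_part_has_derivative:
  "((\<lambda>y. tangent_part (G y) (z y) (p y)) has_derivative
     (\<lambda>h. var_tangent_part (G x) (z x) (p x) (G' h) (p' h) (z' h))) (at x)"
  unfolding tangent_part_def
  by (rule has_derivative_eq_rhs[OF matrix_vector_mult.FDERIV[OF Amat_has_derivative p']])
    (simp add: fun_eq_iff var_tangent_part_def var_metric_def conormal_part_def tangent_part_def
      transpose_normal_proj Bmat_def Amat_def tangent_coord_def matrix_normalize algebra_simps)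

lemma conormal_part_has_derivative:
  "((\<lambda>y. conormal_part (G y) (z y) (p y)) has_derivative
     (\<lambda>h. var_conormal_part (G x) (z x) (p x) (G' h) (p' h) (z' h))) (at x)"
  unfolding conormal_part_def normal_proj_def
  by (rule has_derivative_eq_rhs, (rule derivative_intros z' p' tangent_coord_has_derivative)+)
    (simp add: fun_eq_iff var_conormal_part_def var_tangent_coord_def conormal_part_def
      tangent_part_def transpose_normal_proj Bmat_def normal_proj_def Amat_def tangent_coord_def
      transpose_cometric transpose_metric matrix_normalize algebra_simps)

lemma navigation_s_has_derivative:
  "((\<lambda>y. navigation_s (G y) (z y) (p y) (w y)) has_derivative
     (\<lambda>h. var_s (G x) (z x) (p x) (G' h) (p' h) (w' h) (z' h))) (at x)"
proof -
  let ?u = "tangent_part (G x) (z x) (p x)" and ?\<pi> = "conormal_part (G x) (z x) (p x)"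
  have cometric: "p x \<bullet> (z x *v (cometric (G x) (z x) *v y)) = ?u \<bullet> y" for y
    by (simp add: tangent_part_def Amat_def inner_matrix_vector_transpose matrix_normalize
        transpose_cometric)
  have Amat: "p x \<bullet> (z x *v (Amat (G x) (z x) *v y)) = (z x *v ?u) \<bullet> y" for y
    using cometric by (simp add: Amat_def matrix_normalize inner_matrix_vector_transpose)
  have tangent_coord: "p x \<bullet> (z x *v (tangent_coord (G x) (z x) *v y)) = (p x - ?\<pi>) \<bullet> y" for y
    using Amat by (simp add: tangent_coord_def conormal_part_eq matrix_normalize inner_metric)
  have frame: "?u \<bullet> (transpose Z *v y) = y \<bullet> (Z *v ?u)" for Z :: "real^'n^'m" and y
    by (metis inner_commute inner_matrix_vector_transpose)
  show ?thesis
    unfolding navigation_s_def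
    by (rule has_derivative_eq_rhs,
        (rule derivative_intros z' p' w' tangent_part_has_derivative)+)
      (simp add: fun_eq_iff var_s_def var_tangent_part_def matrix_vector_mult.add_right
        matrix_vector_mult.diff_right inner_add_right inner_diff_right inner_diff_left
        cometric Amat tangent_coord frame inner_commute[of "z x *v ?u"])
qed

lemma sqrt_det_has_derivative:
  "((\<lambda>y. sqrt (det (hmat (G y) (z y)))) has_derivative
     (\<lambda>h. sqrt (det (hmat (G x) (z x))) * var_vol (G x) (z x) (G' h) (z' h))) (at x)"
proof -
  let ?C = "cometric (G x) (z x)"
  have "trace (?C ** (transpose (z' h) ** (G x ** z x))) =
      trace (tangent_coord (G x) (z x) ** z' h)" for h
  proof -
    have "trace (?C ** (transpose (z' h) ** (G x ** z x))) =
        trace (transpose (?C ** (transpose (z' h) ** (G x ** z x))))"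
      by (simp only: trace_transpose)
    also have "\<dots> = trace ((transpose (z x) ** (G x ** z' h)) ** ?C)"
      by (simp add: matrix_normalize transpose_cometric transpose_metric)
    also have "\<dots> = trace (tangent_coord (G x) (z x) ** z' h)"
      by (subst trace_mul_sym) (simp add: tangent_coord_def Amat_def matrix_mul_assoc)
    finally show ?thesis .
  qed
  then have trace: "trace (?C ** var_metric h) = 2 * var_vol (G x) (z x) (G' h) (z' h)" for h
    by (simp add: var_metric_def var_vol_def tangent_coord_def Amat_def matrix_normalize)
  let ?d = "det (hmat (G x) (z x))"
  have "((\<lambda>y. sqrt (det (hmat (G y) (z y)))) has_derivative
      (\<lambda>h. inverse (sqrt ?d) / 2 * (?d * trace (?C ** var_metric h)))) (at x)"
    unfolding cometric_def
    by (rule has_derivative_compose[OF has_derivative_det[OF hmat_has_derivative invertible_induced]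
          DERIV_real_sqrt[OF det_induced, unfolded has_field_derivative_def]])
  moreover have "inverse (sqrt ?d) / 2 * (?d * (2 * v)) = sqrt ?d * v" for v
    using det_induced real_sqrt_mult_self[of ?d] by (simp add: field_simps)
  ultimately show ?thesis by (simp only: trace)
qed

lemma vol_density_has_derivative:
  assumes c: "(c has_real_derivative c (w x) * L) (at (w x))" and pos: "c (w x) > 0"
  shows "((\<lambda>y. vol_density c (G y) (z y) (w y)) has_derivative
     (\<lambda>h. vol_density c (G x) (z x) (w x) * (var_vol (G x) (z x) (G' h) (z' h) - L * w' h))) (at x)"
proof -
  have "((\<lambda>y. c (w y)) has_derivative (\<lambda>h. w' h * (c (w x) * L))) (at x)"
    using has_derivative_compose[OF w' c[unfolded has_field_derivative_def]]
    by (simp add: mult.commute)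
  then show ?thesis
    unfolding vol_density_def
    by (rule has_derivative_eq_rhs[OF has_derivative_divide'[OF sqrt_det_has_derivative]])
      (use pos in \<open>simp_all add: fun_eq_iff field_simps\<close>)
qed

lemma compose_navigation_s_has_derivative:
  assumes "(r has_real_derivative D) (at (navigation_s (G x) (z x) (p x) (w x)))"
  shows "((\<lambda>y. r (navigation_s (G y) (z y) (p y) (w y))) has_derivative
     (\<lambda>h. D * var_s (G x) (z x) (p x) (G' h) (p' h) (w' h) (z' h))) (at x)"
  by (rule has_derivative_compose[OF navigation_s_has_derivative
        assms[unfolded has_field_derivative_def]])

lemma integrand_has_derivative:
  assumes c: "(c has_real_derivative c (w x) * L) (at (w x))" "c (w x) > 0"
    and s: "s = navigation_s (G x) (z x) (p x) (w x)" and r: "(r has_real_derivative r1) (at s)"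
  shows "((\<lambda>y. vol_density c (G y) (z y) (w y) * r (navigation_s (G y) (z y) (p y) (w y)))
     has_derivative (\<lambda>h. vol_density c (G x) (z x) (w x)
       * var_integrand (r s) r1 L (G x) (z x) (p x) (G' h, p' h, w' h, z' h))) (at x)"
  by (rule has_derivative_eq_rhs[OF has_derivative_mult[OF vol_density_has_derivative[OF c]
        compose_navigation_s_has_derivative[OF r[unfolded s]]]])
    (simp add: fun_eq_iff var_integrand_def s algebra_simps)

lemma momentum_has_derivative:
  assumes c: "(c has_real_derivative c (w x) * L) (at (w x))" "c (w x) > 0"
    and s: "s = navigation_s (G x) (z x) (p x) (w x)"
    and r: "(r has_real_derivative r' s) (at s)" and r': "(r' has_real_derivative r2) (at s)"
  shows "((\<lambda>y. vol_density c (G y) (z y) (w y) *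
       momentum (r (navigation_s (G y) (z y) (p y) (w y)))
         (r' (navigation_s (G y) (z y) (p y) (w y))) (G y) (z y) (p y) Y)
     has_derivative (\<lambda>h. vol_density c (G x) (z x) (w x)
       * var_momentum (r s) (r' s) r2 L (G x) (z x) (p x) (G' h, p' h, w' h, z' h) Y)) (at x)"
  unfolding momentum_def
  by (rule has_derivative_eq_rhs,
      (rule derivative_intros vol_density_has_derivative[OF c]
        compose_navigation_s_has_derivative[OF r[unfolded s]]
        compose_navigation_s_has_derivative[OF r'[unfolded s]]
        conormal_part_has_derivative tangent_part_has_derivative tangent_coord_has_derivative)+)
    (simp add: fun_eq_iff var_momentum_def momentum_def s matrix_normalize algebra_simps)

end

subsection \<open>Invariance under linear changes of the ambient space\<close>

lemma hmat_pullback: "hmat (transpose A ** G ** A) z = hmat G (A ** z)"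
  by (simp add: hmat_eq matrix_normalize)

lemma Amat_pullback: "Amat (transpose A ** G ** A) z ** transpose A = Amat G (A ** z)"
  by (simp add: Amat_def cometric_def hmat_pullback matrix_transpose_mul matrix_mul_assoc)

lemma tangent_coord_pullback:
  "tangent_coord (transpose A ** G ** A) z = tangent_coord G (A ** z) ** A"
  by (simp add: tangent_coord_def Amat_pullback[symmetric] matrix_mul_assoc)

lemma tangent_part_pullback:
  "tangent_part (transpose A ** G ** A) z (transpose A *v p) = tangent_part G (A ** z) p"
  by (simp add: tangent_part_def Amat_pullback[symmetric] matrix_vector_mul_assoc)

lemma conormal_part_pullback:
  "conormal_part (transpose A ** G ** A) z (transpose A *v p) =
     transpose A *v conormal_part G (A ** z) p"
proof -
  have "A ** normal_proj (transpose A ** G ** A) z = normal_proj G (A ** z) ** A"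
    by (simp add: normal_proj_def tangent_coord_pullback matrix_mult.diff_left
        matrix_mult.diff_right matrix_mul_assoc)
  then show ?thesis
    by (simp add: conormal_part_def matrix_vector_mul_assoc flip: matrix_transpose_mul)
qed

lemma navigation_s_pullback:
  "navigation_s (transpose A ** G ** A) z (transpose A *v p) w = navigation_s G (A ** z) p w"
  by (simp add: navigation_s_def tangent_part_pullback inner_matrix_vector_transpose
      matrix_vector_mul_assoc)

context frame
begin

text \<open>
  Differentiating the invariance along $A = 1 + tM$ shows that the velocity $(GM + M^TG, M^Tp, 0, 0)$
  is equivalent to moving the frame with velocity $Mz$.
\<close>

lemma
  fixes M :: "real^'m^'m" and p :: "real^'m"
  defines "S \<equiv> G ** M + transpose M ** G" and "q \<equiv> transpose M *v p"
  shows var_tangent_coord_pullback: "var_tangent_coord G z S 0 =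
      var_tangent_coord G z 0 (M ** z) + tangent_coord G z ** M" (is ?coord)
    and var_tangent_part_pullback: "var_tangent_part G z p S q 0 =
      var_tangent_part G z p 0 0 (M ** z)" (is ?tangent)
    and var_conormal_part_pullback: "var_conormal_part G z p S q 0 =
      var_conormal_part G z p 0 0 (M ** z) + transpose M *v conormal_part G z p" (is ?conormal)
    and var_s_pullback: "var_s G z p S q 0 0 = var_s G z p 0 0 0 (M ** z)" (is ?s)
    and var_vol_pullback: "var_vol G z S 0 = var_vol G z 0 (M ** z)" (is ?vol)
proof -
  define A where "A t = mat 1 + t *\<^sub>R M" for t :: real
  have A: "(A has_derivative (\<lambda>t. t *\<^sub>R M)) (at 0)"
    unfolding A_def by (auto intro!: derivative_eq_intros)
  have A0: "A 0 = mat 1" by (simp add: A_def)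
  interpret pulled: variation "\<lambda>t. transpose (A t) ** G ** A t" "\<lambda>t. z" "\<lambda>t. transpose (A t) *v p"
    "\<lambda>t. 0" "\<lambda>t. t *\<^sub>R S" "\<lambda>t. 0" "\<lambda>t. t *\<^sub>R q" "\<lambda>t. 0" "0 :: real"
    by unfold_locales (auto intro!: derivative_eq_intros A
        simp: A0 S_def q_def matrix_normalize algebra_simps positive inj)
  interpret moved: variation "\<lambda>t. G" "\<lambda>t. A t ** z" "\<lambda>t. p"
    "\<lambda>t. 0" "\<lambda>t. 0" "\<lambda>t. t *\<^sub>R (M ** z)" "\<lambda>t. 0" "\<lambda>t. 0" "0 :: real"
    by unfold_locales (auto intro!: derivative_eq_intros A
        simp: A0 matrix_normalize positive inj)
  show ?coord
    using fun_cong[OF has_derivative_unique[OF pulled.tangent_coord_has_derivative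
        matrix_mult.FDERIV[OF moved.tangent_coord_has_derivative A,
          folded tangent_coord_pullback]], of 1]
    by (simp add: A0)
  show ?tangent
    using fun_cong[OF has_derivative_unique[OF pulled.tangent_part_has_derivative
        moved.tangent_part_has_derivative[folded tangent_part_pullback]], of 1]
    by (simp add: A0)
  show ?conormal
    using fun_cong[OF has_derivative_unique[OF pulled.conormal_part_has_derivative
        matrix_vector_mult.FDERIV[OF bounded_linear.has_derivative[OF bounded_linear_transpose A]
          moved.conormal_part_has_derivative, folded conormal_part_pullback]], of 1]
    by (simp add: A0)
  show ?s
    using fun_cong[OF has_derivative_unique[OF pulled.navigation_s_has_derivative
        moved.navigation_s_has_derivative[folded navigation_s_pullback]], of 1]
    by (simp add: A0)
  show ?vol
    using fun_cong[OF has_derivative_unique[OF pulled.sqrt_det_has_derivative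
        moved.sqrt_det_has_derivative[folded hmat_pullback]], of 1] det_induced
    by (simp add: A0)
qed

lemma var_integrand_pullback:
  "var_integrand r0 r1 L G z p (G ** M + transpose M ** G, transpose M *v p, 0, 0) =
     momentum r0 r1 G z p (M ** z)"
  unfolding var_integrand_frame[where L = L, symmetric]
  by (simp add: var_integrand_def var_s_pullback var_vol_pullback)

lemma var_momentum_pullback:
  "var_momentum r0 r1 r2 L G z p (G ** M + transpose M ** G, transpose M *v p, 0, 0) Y =
     var_momentum r0 r1 r2 L G z p (0, 0, 0, M ** z) Y + momentum r0 r1 G z p (M ** Y)"
  by (simp add: var_momentum_def var_tangent_coord_pullback var_tangent_part_pullback
      var_conormal_part_pullback var_s_pullback var_vol_pullback momentum_def matrix_normalize
      inner_matrix_vector_transpose inner_add_left algebra_simps)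

subsection \<open>Tangential and normal variations of the frame\<close>

lemma var_momentum_tangential:
  "var_momentum r0 r1 r2 L G z p (0, 0, 0, z ** K) Y =
     trace K * momentum r0 r1 G z p Y - momentum r0 r1 G z p (Y ** K)"
proof -
  have coord: "tangent_coord G z ** (z ** N) = N" for N :: "real^'k^'n"
    by (simp add: tangent_coord_frame matrix_mul_assoc)
  have proj: "normal_proj G z *v (z *v x) = 0" for x
    by (simp add: normal_proj_frame matrix_vector_mul_assoc)
  have transpose_proj: "transpose z ** (transpose (normal_proj G z) ** N) = 0" for N :: "real^'k^'m"
    by (simp add: matrix_mul_assoc normal_proj_frame flip: matrix_transpose_mul)
      (simp add: matrix_normalize)
  have conormal: "conormal_part G z p \<bullet> (z *v x) = 0" for x
    by (simp add: inner_commute[of "conormal_part G z p"] inner_matrix_vector_transpose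
        transpose_frame_conormal_part)
  have "trace (K ** (tangent_coord G z ** Y)) = trace (tangent_coord G z ** (Y ** K))"
    by (metis matrix_mul_assoc trace_mul_sym)
  then show ?thesis
    by (simp add: var_momentum_def var_vol_def var_s_def var_conormal_part_def var_tangent_part_def
        var_tangent_coord_def matrix_normalize coord tangent_coord_frame_vec
        transpose_frame_conormal_part proj transpose_proj conormal inner_simps momentum_def
        algebra_simps)
qed

lemma var_momentum_normal:
  assumes N: "transpose N ** (G ** z) = 0"
  shows "var_momentum r0 r1 r2 L G z p (0, 0, 0, N) Y =
     2 * (p \<bullet> (N *v tangent_part G z p)) * momentum r1 r2 G z p Y
     + 2 * r1 * (conormal_part G z p \<bullet> (Y *v (cometric G z *v (transpose N *v p)))
       - p \<bullet> (N *v (tangent_coord G z *v (Y *v tangent_part G z p)))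
       - (G *v (N *v tangent_part G z p)) \<bullet> (Y *v tangent_part G z p))
     + r0 * trace (cometric G z ** (transpose N ** (G ** Y)))"
proof -
  have coord: "tangent_coord G z ** N = 0"
    using arg_cong[OF N, of transpose]
    by (simp add: matrix_normalize transpose_metric tangent_coord_def Amat_def)
  then have coord_vec: "tangent_coord G z *v (N *v x) = 0"
    and coord_mult: "tangent_coord G z ** (N ** K) = 0" for x and K :: "real^'k^'n"
    by (simp_all add: matrix_vector_mul_assoc matrix_mul_assoc)
  have proj: "normal_proj G z ** N = N"
    by (simp add: normal_proj_def matrix_normalize coord)
  then have proj_vec: "normal_proj G z *v (N *v x) = N *v x" for x
    by (simp add: matrix_vector_mul_assoc)
  have transpose_proj: "transpose N ** transpose (normal_proj G z) = transpose N"
    using arg_cong[OF proj, of transpose] by (simp add: matrix_transpose_mul)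
  then have transpose_proj_mult:
      "transpose N ** (transpose (normal_proj G z) ** K) = transpose N ** K" for K :: "real^'k^'m"
    by (simp add: matrix_mul_assoc)
  have conormal: "transpose N *v conormal_part G z p = transpose N *v p"
    by (simp add: conormal_part_def transpose_proj matrix_vector_mul_assoc)
  then have conormal_inner: "conormal_part G z p \<bullet> (N *v x) = p \<bullet> (N *v x)" for x
    by (metis inner_commute inner_matrix_vector_transpose)
  have transpose_coord: "(transpose (tangent_coord G z) *v (transpose N *v x)) \<bullet> y =
      x \<bullet> (N *v (tangent_coord G z *v y))" for x y
    by (simp add: inner_matrix_vector_transpose)
  show ?thesis
    by (simp add: var_momentum_def var_vol_def var_s_def var_conormal_part_def var_tangent_part_def
        var_tangent_coord_def matrix_normalize coord coord_vec coord_mult conormal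
        transpose_proj_mult proj_vec conormal_inner transpose_coord inner_simps momentum_def
        algebra_simps)
qed

lemma var_momentum_covector:
  "var_momentum r0 r1 r2 L G z p (0, q, \<omega>, 0) Y =
     - L * \<omega> * momentum r0 r1 G z p Y
     + (2 * (q \<bullet> (z *v tangent_part G z p)) - \<omega>) * momentum r1 r2 G z p Y
     + 2 * r1 * ((transpose (normal_proj G z) *v q) \<bullet> (Y *v tangent_part G z p)
       + conormal_part G z p \<bullet> (Y *v (Amat G z *v q)))"
  by (simp add: var_momentum_def var_conormal_part_def var_tangent_part_def var_tangent_coord_def
      var_vol_def var_s_def matrix_normalize)

end

subsection \<open>Outer products\<close>

definition outer :: "real^'m \<Rightarrow> real^'n \<Rightarrow> real^'n^'m" where
  "outer x y = (\<chi> a i. x $ a * y $ i)"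

interpretation outer: bounded_bilinear "outer :: real^'m \<Rightarrow> real^'n \<Rightarrow> real^'n^'m"
  by (subst bilinear_conv_bounded_bilinear[symmetric])
    (auto simp: bilinear_def linear_iff outer_def vec_eq_iff algebra_simps)

lemma outer_mult_vec: "outer x y *v v = (y \<bullet> v) *\<^sub>R x"
  by (simp add: outer_def matrix_vector_mult_def inner_vec_def vec_eq_iff sum_distrib_left mult_ac)

lemma matrix_mult_outer: "M ** outer x y = outer (M *v x) y" for M :: "real^'m^'k"
  by (simp add: outer_def matrix_matrix_mult_def matrix_vector_mult_def vec_eq_iff sum_distrib_left
      sum_distrib_right mult_ac)

lemma outer_mult_matrix: "outer x y ** K = outer x (transpose K *v y)" for K :: "real^'k^'n"
  by (simp add: outer_def matrix_matrix_mult_def matrix_vector_mult_def transpose_def vec_eq_iff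
      sum_distrib_left mult_ac)

lemma trace_outer: "trace (outer x y) = y \<bullet> x"
  by (simp add: trace_def outer_def inner_vec_def mult.commute)

lemma axis_axis_eq_outer: "axis c (axis i 1) = outer (axis c 1) (axis i 1)"
  by (simp add: outer_def axis_def vec_eq_iff)

lemma sum_scaleR_axis: "(\<Sum>i\<in>UNIV. v $ i *\<^sub>R axis i 1) = v" for v :: "real^'n"
  using basis_expansion[of v] by (simp add: scalar_mult_eq_scaleR)

lemma sum_outer_axis: "(\<Sum>i\<in>UNIV. outer (M *v axis i 1) (axis i 1)) = M" for M :: "real^'n^'m"
proof -
  have "(\<Sum>i\<in>UNIV. outer (M *v axis i 1) (axis i 1)) = M ** (\<Sum>i\<in>UNIV. outer (axis i 1) (axis i 1))"
    by (simp add: matrix_mult.sum_right matrix_mult_outer)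
  also have "(\<Sum>i\<in>UNIV. outer (axis i 1) (axis i 1)) = (mat 1 :: real^'n^'n)"
    by (auto simp: vec_eq_iff outer_def mat_def axis_def if_distrib[of "\<lambda>x. x * _"] cong: if_cong)
  finally show ?thesis by simp
qed

lemma linear_outer_axis_sum:
  fixes F :: "real^'n^'m \<Rightarrow> real"
  assumes "linear F"
  shows "(\<Sum>i\<in>UNIV. v $ i * F (outer x (axis i 1))) = F (outer x v)"
proof -
  have "F (outer x v) = F (outer x (\<Sum>i\<in>UNIV. v $ i *\<^sub>R axis i 1))"
    by (simp only: sum_scaleR_axis)
  then show ?thesis
    by (simp add: outer.sum_right outer.scaleR_right linear_sum[OF assms] linear_scale[OF assms])
qed

lemma inner_matrix_axis: "x \<bullet> (M *v axis i 1) = (transpose M *v x) $ i" for M :: "real^'n^'m"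
  by (simp add: inner_commute[of x] inner_matrix_vector_transpose inner_axis')

lemma matrix_vector_mult_axis: "(M *v axis j 1) $ a = M $ a $ j" for M :: "real^'n^'m"
  by (simp add: matrix_vector_mult_basis column_def)

lemma trace_eq_sum_axis: "trace M = (\<Sum>i\<in>UNIV. (M *v axis i 1) $ i)" for M :: "real^'n^'n"
  by (simp add: trace_def matrix_vector_mult_axis)

lemma inner_skew: "transpose R = - R \<Longrightarrow> (R *v x) \<bullet> y = - (x \<bullet> (R *v y))" for R :: "real^'n^'n"
  by (simp add: inner_matrix_vector_transpose matrix_normalize)

lemma trace_symmetric_mult_skew:
  fixes C R :: "real^'n^'n"
  assumes "transpose C = C" "transpose R = - R"
  shows "trace (C ** R) = 0"
proof -
  have "trace (C ** R) = trace (transpose (C ** R))" by (simp only: trace_transpose)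
  also have "\<dots> = - trace (C ** R)"
    using assms by (simp add: matrix_normalize trace_mul_sym[of R])
  finally show ?thesis by simp
qed

subsection \<open>The Euler-Lagrange expression of the integrand\<close>

lemma momentum_outer:
  "momentum r0 r1 G z p (outer x y) = 2 * r1 * (conormal_part G z p \<bullet> x) * (y \<bullet> tangent_part G z p)
     + r0 * (y \<bullet> (tangent_coord G z *v x))"
  by (simp add: momentum_def outer_mult_vec matrix_mult_outer trace_outer)

context frame
begin

lemma var_integrand_covariant:
  "var_integrand r0 r1 L G z p (G ** M + transpose M ** G, q + transpose M *v p, \<omega>, 0) =
     var_integrand r0 r1 L G z p (0, q, \<omega>, 0) + momentum r0 r1 G z p (M ** z)"
proof -
  have "(G ** M + transpose M ** G, q + transpose M *v p, \<omega>, 0) =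
      (0, q, \<omega>, 0) + (G ** M + transpose M ** G, transpose M *v p, 0, 0 :: real^'n^'m)"
    by simp
  then show ?thesis
    by (simp only: linear_add[OF linear_var_integrand] var_integrand_pullback)
qed

lemma var_momentum_covariant:
  "var_momentum r0 r1 r2 L G z p
       (G ** M + transpose M ** G, q + transpose M *v p, \<omega>, Z - M ** z) Y =
     var_momentum r0 r1 r2 L G z p (0, q, \<omega>, 0) Y + var_momentum r0 r1 r2 L G z p (0, 0, 0, Z) Y
     + momentum r0 r1 G z p (M ** Y)"
proof -
  have "(G ** M + transpose M ** G, q + transpose M *v p, \<omega>, Z - M ** z) =
      (0, q, \<omega>, 0) + (0, 0, 0, Z)
      + ((G ** M + transpose M ** G, transpose M *v p, 0, 0) - (0, 0, 0, M ** z))"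
    by simp
  then show ?thesis
    by (simp only: linear_add[OF linear_var_momentum] linear_diff[OF linear_var_momentum]
        var_momentum_pullback)
qed

lemma sum_var_momentum_reparametrization:
  fixes K :: "'n \<Rightarrow> real^'n^'n"
  assumes K: "\<And>i j. K i *v axis j 1 = K j *v axis i 1"
  shows "(\<Sum>i\<in>UNIV. var_momentum r0 r1 r2 L G z p (0, 0, 0, z ** K i) (outer x (axis i 1))) = 0"
proof -
  let ?F = "momentum r0 r1 G z p"
  define k where "k = (\<chi> i. trace (K i))"
  have "(\<Sum>i\<in>UNIV. transpose (K i) *v axis i 1) $ j = k $ j" for j
  proof -
    have "(transpose (K i) *v axis i 1) $ j = (K j *v axis i 1) $ i" for i
      using arg_cong[OF K[of i j], of "\<lambda>v. v $ i"]
      by (simp add: matrix_vector_mult_axis transpose_def[of "K i"])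
    then show ?thesis by (simp add: k_def trace_eq_sum_axis)
  qed
  then have sum_K: "(\<Sum>i\<in>UNIV. transpose (K i) *v axis i 1) = k" by (simp add: vec_eq_iff)
  have "(\<Sum>i\<in>UNIV. trace (K i) * ?F (outer x (axis i 1))) = ?F (outer x k)"
    using linear_outer_axis_sum[OF linear_momentum, of k r0 r1 G z p x] by (simp add: k_def)
  moreover have "(\<Sum>i\<in>UNIV. ?F (outer x (axis i 1) ** K i)) = ?F (outer x k)"
    unfolding outer_mult_matrix linear_sum[OF linear_momentum, symmetric]
      outer.sum_right[symmetric] sum_K ..
  ultimately show ?thesis
    by (simp add: var_momentum_tangential sum_subtractf)
qed

lemma euler_lagrange_covariant:
  fixes \<Gamma> :: "real^'m \<Rightarrow> real^'m^'m" and K :: "'n \<Rightarrow> real^'n^'n" and N :: "'n \<Rightarrow> real^'n^'m"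
    and R :: "real^'m^'m" and p \<omega> :: "real^'m"
  assumes \<Gamma>: "\<And>v w. \<Gamma> v *v w = \<Gamma> w *v v" and K: "\<And>i j. K i *v axis j 1 = K j *v axis i 1"
  defines "\<delta> \<equiv> \<lambda>v Z. (G ** \<Gamma> v + transpose (\<Gamma> v) ** G, R *v v + transpose (\<Gamma> v) *v p, \<omega> \<bullet> v, Z)"
    and "dz \<equiv> \<lambda>i. z *v axis i 1"
  shows "var_integrand r0 r1 L G z p (\<delta> x 0) - (\<Sum>i\<in>UNIV. var_momentum r0 r1 r2 L G z p
        (\<delta> (dz i) (N i + z ** K i - \<Gamma> (dz i) ** z)) (outer x (axis i 1)))
    = var_integrand r0 r1 L G z p (0, R *v x, \<omega> \<bullet> x, 0)
      - (\<Sum>i\<in>UNIV. var_momentum r0 r1 r2 L G z p (0, R *v dz i, \<omega> \<bullet> dz i, 0) (outer x (axis i 1)))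
      - (\<Sum>i\<in>UNIV. var_momentum r0 r1 r2 L G z p (0, 0, 0, N i) (outer x (axis i 1)))"
proof -
  have "\<Gamma> (dz i) ** outer x (axis i 1) = outer ((\<Gamma> x ** z) *v axis i 1) (axis i 1)" for i
    by (simp add: matrix_mult_outer \<Gamma>[of _ x] dz_def matrix_vector_mul_assoc)
  then have "(\<Sum>i\<in>UNIV. momentum r0 r1 G z p (\<Gamma> (dz i) ** outer x (axis i 1))) =
      momentum r0 r1 G z p (\<Gamma> x ** z)"
    by (simp only: linear_sum[OF linear_momentum, symmetric] sum_outer_axis)
  moreover have "var_momentum r0 r1 r2 L G z p (0, 0, 0, N i + z ** K i) Y =
      var_momentum r0 r1 r2 L G z p (0, 0, 0, N i) Y
      + var_momentum r0 r1 r2 L G z p (0, 0, 0, z ** K i) Y" for i Y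
    using linear_add[OF linear_var_momentum,
        of r0 r1 r2 L G z p "(0, 0, 0, N i)" "(0, 0, 0, z ** K i)" Y]
    by simp
  ultimately show ?thesis
    by (simp add: \<delta>_def var_integrand_covariant var_momentum_covariant sum.distrib
        sum_var_momentum_reparametrization[OF K])
qed

lemma momentum_outer_axis_frame:
  "momentum r0 r1 G z p (outer (axis c 1) (transpose z *v x)) =
     2 * r1 * conormal_part G z p $ c * (x \<bullet> (z *v tangent_part G z p))
     + r0 * (x - transpose (normal_proj G z) *v x) $ c"
proof -
  have "(transpose z *v x) \<bullet> y = x \<bullet> (z *v y)" for y
    by (simp add: inner_matrix_vector_transpose)
  moreover have "x \<bullet> (z *v (tangent_coord G z *v axis c 1)) =
      (x - transpose (normal_proj G z) *v x) $ c"
  proof -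
    have "z *v (tangent_coord G z *v axis c 1) = axis c 1 - normal_proj G z *v axis c 1"
      by (simp add: normal_proj_def matrix_normalize)
    then show ?thesis
      by (simp add: inner_diff_right inner_axis inner_matrix_axis)
  qed
  ultimately show ?thesis by (simp add: momentum_outer inner_axis)
qed

lemma sum_var_momentum_skew:
  fixes p \<omega> :: "real^'m"
  assumes R: "transpose R = - R"
  defines "u \<equiv> tangent_part G z p" and "dz \<equiv> \<lambda>i. z *v axis i 1"
  shows "(\<Sum>i\<in>UNIV. var_momentum r0 r1 r2 L G z p (0, R *v dz i, \<omega> \<bullet> dz i, 0)
        (outer (axis c 1) (axis i 1)))
    = - L * momentum r0 r1 G z p (outer (axis c 1) (transpose z *v \<omega>))
      - momentum r1 r2 G z p (outer (axis c 1) (transpose z *v (2 *\<^sub>R (R *v (z *v u)) + \<omega>)))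
      + 2 * r1 * (transpose (normal_proj G z) *v (R *v (z *v u))) $ c"
proof -
  let ?P = "transpose (normal_proj G z)" and ?E = "\<lambda>i. outer (axis c 1) (axis i 1) :: real^'n^'m"
  define y where "y = transpose z *v (2 *\<^sub>R (R *v (z *v u)) + \<omega>)"
  have "(R *v dz i) \<bullet> (z *v u) = - ((R *v (z *v u)) \<bullet> dz i)" for i
    using inner_skew[OF R, of "dz i" "z *v u"] by (simp add: inner_commute)
  then have y: "2 * ((R *v dz i) \<bullet> (z *v u)) - \<omega> \<bullet> dz i = - y $ i" for i
    by (simp add: y_def dz_def inner_matrix_axis[symmetric] inner_add_left)
  have conormal: "(\<Sum>i\<in>UNIV. (?P *v (R *v dz i)) $ c * u $ i) = (?P *v (R *v (z *v u))) $ c"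
  proof -
    have "?P *v (R *v (z *v u)) = ?P *v (R *v (z *v (\<Sum>i\<in>UNIV. u $ i *\<^sub>R axis i 1)))"
      by (simp only: sum_scaleR_axis)
    then show ?thesis
      by (simp add: dz_def matrix_vector_mult.sum_right matrix_vector_mult.scaleR_right
          mult.commute)
  qed
  have tangent: "(\<Sum>i\<in>UNIV. (Amat G z *v (R *v dz i)) $ i) = 0"
  proof -
    have "(\<Sum>i\<in>UNIV. (Amat G z *v (R *v dz i)) $ i) =
        trace (cometric G z ** (transpose z ** (R ** z)))"
      by (simp add: trace_eq_sum_axis dz_def Amat_def matrix_normalize)
    then show ?thesis
      by (simp add: trace_symmetric_mult_skew transpose_cometric R matrix_normalize)
  qed
  have "(\<Sum>i\<in>UNIV. var_momentum r0 r1 r2 L G z p (0, R *v dz i, \<omega> \<bullet> dz i, 0) (?E i)) =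
     - L * (\<Sum>i\<in>UNIV. (transpose z *v \<omega>) $ i * momentum r0 r1 G z p (?E i))
     - (\<Sum>i\<in>UNIV. y $ i * momentum r1 r2 G z p (?E i))
     + 2 * r1 * ((\<Sum>i\<in>UNIV. (?P *v (R *v dz i)) $ c * u $ i)
       + conormal_part G z p $ c * (\<Sum>i\<in>UNIV. (Amat G z *v (R *v dz i)) $ i))"
    unfolding var_momentum_covector y[unfolded u_def]
    by (simp add: dz_def inner_matrix_axis outer_mult_vec inner_axis inner_axis' u_def sum.distrib
        sum_subtractf sum_negf sum_distrib_left algebra_simps)
  then show ?thesis
    by (simp only: linear_outer_axis_sum[OF linear_momentum] conormal tangent y_def mult_zero_right
        add_0_right)
qed

lemma euler_lagrange_skew:
  fixes p \<omega> :: "real^'m"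
  assumes R: "transpose R = - R"
  defines "u \<equiv> tangent_part G z p" and "\<pi> \<equiv> conormal_part G z p" and "P \<equiv> normal_proj G z"
    and "dz \<equiv> \<lambda>i. z *v axis i 1"
  shows "var_integrand r0 r1 L G z p (0, R *v axis c 1, \<omega> \<bullet> axis c 1, 0)
     - (\<Sum>i\<in>UNIV. var_momentum r0 r1 r2 L G z p (0, R *v dz i, \<omega> \<bullet> dz i, 0)
         (outer (axis c 1) (axis i 1)))
    = L * (2 * r1 * \<pi> $ c * (\<omega> \<bullet> (z *v u)) - r0 * (transpose P *v \<omega>) $ c)
      + (2 * r2 * \<pi> $ c * (\<omega> \<bullet> (z *v u)) - r1 * (transpose P *v \<omega>) $ c)
      - 4 * r1 * (transpose P *v (R *v (z *v u))) $ c"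
proof -
  have "(R *v axis c 1) \<bullet> (z *v u) = - (R *v (z *v u)) $ c"
    by (simp add: inner_skew[OF R] inner_axis')
  then have "var_integrand r0 r1 L G z p (0, R *v axis c 1, \<omega> \<bullet> axis c 1, 0) =
      - L * \<omega> $ c * r0 - r1 * (2 * (R *v (z *v u)) $ c + \<omega> $ c)"
    by (simp add: var_integrand_def var_vol_def var_s_def matrix_normalize inner_axis
        u_def[symmetric] algebra_simps)
  moreover have "(R *v (z *v u)) \<bullet> (z *v u) = 0"
    using inner_skew[OF R, of "z *v u" "z *v u"] by (simp add: inner_commute)
  ultimately show ?thesis
    unfolding dz_def sum_var_momentum_skew[OF R] momentum_outer_axis_frame
      u_def[symmetric] \<pi>_def[symmetric] P_def[symmetric]
    by (simp add: matrix_vector_mult.add_right matrix_vector_mult.scaleR_right inner_add_left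
        algebra_simps)
qed

lemma sum_inner_symmetric_swap:
  fixes N :: "'n \<Rightarrow> real^'n^'m" and p :: "real^'m"
  assumes "\<And>i j. N i *v axis j 1 = N j *v axis i 1"
  shows "(\<Sum>i\<in>UNIV. x $ i * (p \<bullet> (N i *v y))) = (\<Sum>i\<in>UNIV. y $ i * (p \<bullet> (N i *v x)))"
proof -
  have expand: "p \<bullet> (N i *v y) = (\<Sum>j\<in>UNIV. y $ j * (p \<bullet> (N i *v axis j 1)))" for i y
  proof -
    have "N i *v y = N i *v (\<Sum>j\<in>UNIV. y $ j *\<^sub>R axis j 1)" by (simp only: sum_scaleR_axis)
    then show ?thesis
      by (simp add: matrix_vector_mult.sum_right matrix_vector_mult.scaleR_right inner_sum_right)
  qed
  have "(\<Sum>i\<in>UNIV. x $ i * (p \<bullet> (N i *v y))) =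
      (\<Sum>i\<in>UNIV. \<Sum>j\<in>UNIV. x $ i * (y $ j * (p \<bullet> (N i *v axis j 1))))"
    unfolding expand[of _ y] sum_distrib_left ..
  also have "\<dots> = (\<Sum>j\<in>UNIV. \<Sum>i\<in>UNIV. y $ j * (x $ i * (p \<bullet> (N j *v axis i 1))))"
    by (subst sum.swap) (intro sum.cong refl, subst assms, simp)
  finally show ?thesis
    unfolding expand[of _ x] sum_distrib_left .
qed

lemma sum_var_momentum_normal:
  fixes N :: "'n \<Rightarrow> real^'n^'m" and p :: "real^'m"
  assumes N: "\<And>i. transpose (N i) ** (G ** z) = 0"
    and sym: "\<And>i j. N i *v axis j 1 = N j *v axis i 1"
  defines "u \<equiv> tangent_part G z p" and "\<pi> \<equiv> conormal_part G z p"
  shows "(\<Sum>i\<in>UNIV. var_momentum r0 r1 r2 L G z p (0, 0, 0, N i) (outer (axis c 1) (axis i 1))) =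
    (\<Sum>i\<in>UNIV. 2 * r1 * \<pi> $ c * (cometric G z *v (transpose (N i) *v p)) $ i
      + r0 * (cometric G z *v (transpose (N i) *v (G *v axis c 1))) $ i
      + 4 * r2 * \<pi> $ c * (u $ i * (p \<bullet> (N i *v u))) - 2 * r1 * (u $ i * (G *v (N i *v u)) $ c))"
proof -
  let ?a = "tangent_coord G z *v axis c 1"
  have "var_momentum r0 r1 r2 L G z p (0, 0, 0, N i) (outer (axis c 1) (axis i 1)) =
    (2 * r1 * \<pi> $ c * (cometric G z *v (transpose (N i) *v p)) $ i
      + r0 * (cometric G z *v (transpose (N i) *v (G *v axis c 1))) $ i
      + 4 * r2 * \<pi> $ c * (u $ i * (p \<bullet> (N i *v u))) - 2 * r1 * (u $ i * (G *v (N i *v u)) $ c))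
    + 2 * r1 * (?a $ i * (p \<bullet> (N i *v u)) - u $ i * (p \<bullet> (N i *v ?a)))" for i
    unfolding var_momentum_normal[OF N] momentum_outer u_def[symmetric] \<pi>_def[symmetric]
    by (simp add: matrix_mult_outer trace_outer outer_mult_vec matrix_vector_mult.scaleR_right
        inner_axis inner_axis' algebra_simps)
  then show ?thesis
    by (simp add: sum.distrib sum_distrib_left[symmetric] sum_subtractf
        sum_inner_symmetric_swap[OF sym, of ?a])
qed

end

subsection \<open>Directional derivatives and Schwarz's theorem\<close>

lemma has_derivative_line_real:
  assumes "(\<phi> has_derivative D) (at (y + s *\<^sub>R v))"
  shows "((\<lambda>r. \<phi> (y + r *\<^sub>R v)) has_real_derivative D v) (at s)"
proof -
  have "((\<lambda>r. y + r *\<^sub>R v) has_derivative (\<lambda>r. r *\<^sub>R v)) (at s)"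
    by (auto intro!: derivative_eq_intros)
  from has_derivative_compose[OF this assms] show ?thesis
    using linear_scale[OF has_derivative_linear[OF assms]]
    by (simp add: has_field_derivative_def mult_commute_abs)
qed

lemma pd_eq:
  assumes "(\<phi> has_derivative D) (at a)"
  shows "pd \<phi> v a = D v"
  using has_derivative_line_real[of \<phi> D a 0 v] assms by (simp add: pd_def DERIV_imp_deriv)

lemma has_derivative_pd:
  assumes "\<phi> differentiable (at a)"
  shows "(\<phi> has_derivative (\<lambda>v. pd \<phi> v a)) (at a)"
proof -
  obtain D where D: "(\<phi> has_derivative D) (at a)" using assms by (auto simp: differentiable_def)
  then have "D = (\<lambda>v. pd \<phi> v a)" by (simp add: fun_eq_iff pd_eq)
  with D show ?thesis by simp
qed

lemma has_derivative_remainder_along: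
  fixes f :: "'a::real_normed_vector \<Rightarrow> 'b::real_normed_vector"
  assumes D: "(f has_derivative D) (at x)" and h: "\<forall>\<^sub>F t in at_right 0. norm (h t) \<le> k * t"
  shows "((\<lambda>t. (f (x + h t) - f x - D (h t)) /\<^sub>R t) \<longlongrightarrow> 0) (at_right 0)"
proof (rule tendstoI)
  fix e :: real assume "e > 0"
  define K where "K = \<bar>k\<bar> + 1"
  have "K > 0" by (simp add: K_def)
  obtain d where "d > 0"
    and d: "\<And>y. norm (y - x) < d \<Longrightarrow> norm (f y - f x - D (y - x)) \<le> e / (2 * K) * norm (y - x)"
    using D \<open>e > 0\<close> \<open>K > 0\<close> unfolding has_derivative_at_alt
    by (metis divide_pos_pos mult_pos_pos zero_less_numeral)
  have "\<forall>\<^sub>F t in at_right 0. t \<in> {0<..<d / K}"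
    using \<open>d > 0\<close> \<open>K > 0\<close> by (intro eventually_at_right_real) simp
  with h show "\<forall>\<^sub>F t in at_right 0. dist ((f (x + h t) - f x - D (h t)) /\<^sub>R t) 0 < e"
  proof eventually_elim
    case (elim t)
    then have t: "0 < t" "K * t < d" using \<open>K > 0\<close> by (auto simp: field_simps)
    have "k * t \<le> K * t" using t by (intro mult_right_mono) (auto simp: K_def)
    with elim(1) have h: "norm (h t) \<le> K * t" by linarith
    have "norm (f (x + h t) - f x - D (h t)) \<le> e / (2 * K) * norm (h t)"
      using d[of "x + h t"] h t by simp
    also have "\<dots> \<le> e / (2 * K) * (K * t)"
      using h \<open>e > 0\<close> \<open>K > 0\<close> by (intro mult_left_mono) auto
    also have "\<dots> < e * t"
      using t \<open>e > 0\<close> \<open>K > 0\<close> by (simp add: field_simps)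
    finally show ?case
      using t by (simp add: inverse_eq_divide pos_divide_less_eq)
  qed
qed

lemma second_difference_mean_value:
  fixes \<phi> :: "'a::real_normed_vector \<Rightarrow> real"
  assumes "t > 0"
    and \<phi>: "\<And>s r. 0 \<le> s \<Longrightarrow> s \<le> t \<Longrightarrow> r \<in> {0, t} \<Longrightarrow>
      \<phi> differentiable (at (x + r *\<^sub>R w + s *\<^sub>R v))"
  shows "\<exists>\<xi>. 0 < \<xi> \<and> \<xi> < t \<and> \<phi> (x + t *\<^sub>R w + t *\<^sub>R v) - \<phi> (x + t *\<^sub>R w) - \<phi> (x + t *\<^sub>R v) + \<phi> x
    = t * (pd \<phi> v (x + t *\<^sub>R w + \<xi> *\<^sub>R v) - pd \<phi> v (x + \<xi> *\<^sub>R v))"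
proof -
  let ?g = "\<lambda>s. \<phi> (x + t *\<^sub>R w + s *\<^sub>R v) - \<phi> (x + s *\<^sub>R v)"
  have "(?g has_real_derivative pd \<phi> v (x + t *\<^sub>R w + s *\<^sub>R v) - pd \<phi> v (x + s *\<^sub>R v)) (at s)"
    if "0 \<le> s" "s \<le> t" for s
    using \<phi>[OF that, of t] \<phi>[OF that, of 0]
    by (intro DERIV_diff has_derivative_line_real has_derivative_pd) auto
  from MVT2[OF \<open>t > 0\<close> this] show ?thesis by (simp add: algebra_simps)
qed

lemma norm_add_scaleR_le:
  fixes v w :: "'a::real_normed_vector"
  assumes "0 \<le> r" "r \<le> t" "0 \<le> s" "s \<le> t"
  shows "norm (r *\<^sub>R w + s *\<^sub>R v) \<le> (norm w + norm v) * t"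
  unfolding distrib_right using assms
  by (intro norm_triangle_mono) (auto simp: mult.commute[of _ t] intro: mult_right_mono)

lemma eventually_second_difference_mean_value:
  fixes \<phi> :: "'a::real_normed_vector \<Rightarrow> real"
  assumes S: "open S" "x \<in> S" and \<phi>: "\<And>y. y \<in> S \<Longrightarrow> \<phi> differentiable (at y)"
  shows "\<forall>\<^sub>F t in at_right 0. \<exists>\<xi>. 0 < \<xi> \<and> \<xi> < t \<and>
    \<phi> (x + t *\<^sub>R w + t *\<^sub>R v) - \<phi> (x + t *\<^sub>R w) - \<phi> (x + t *\<^sub>R v) + \<phi> x
    = t * (pd \<phi> v (x + t *\<^sub>R w + \<xi> *\<^sub>R v) - pd \<phi> v (x + \<xi> *\<^sub>R v))"
proof -
  define k where "k = norm w + norm v"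
  obtain d where d: "d > 0" "ball x d \<subseteq> S" using S open_contains_ball by blast
  have "k \<ge> 0" by (simp add: k_def)
  then have "\<forall>\<^sub>F t in at_right 0. t \<in> {0<..<d / (k + 1)}"
    using d(1) by (intro eventually_at_right_real) simp
  then show ?thesis
  proof eventually_elim
    case (elim t)
    show ?case
    proof (intro second_difference_mean_value \<phi>)
      fix s r assume sr: "0 \<le> s" "s \<le> t" "r \<in> {0, t}"
      have "norm (r *\<^sub>R w + s *\<^sub>R v) \<le> k * t"
        unfolding k_def using sr elim by (intro norm_add_scaleR_le) auto
      moreover have "k * t < d" using elim \<open>k \<ge> 0\<close> by (simp add: field_simps)
      ultimately have "x + (r *\<^sub>R w + s *\<^sub>R v) \<in> ball x d"
        by (simp only: mem_ball dist_norm add_diff_cancel_left' norm_minus_commute[of x])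
      with d(2) show "x + r *\<^sub>R w + s *\<^sub>R v \<in> S" by (auto simp: add.assoc)
    qed (use elim in simp)
  qed
qed

lemma second_difference_tendsto:
  fixes \<phi> :: "'a::real_normed_vector \<Rightarrow> real"
  assumes S: "open S" "x \<in> S" and \<phi>: "\<And>y. y \<in> S \<Longrightarrow> \<phi> differentiable (at y)"
    and D: "(pd \<phi> v has_derivative D) (at x)"
  shows "((\<lambda>t. (\<phi> (x + t *\<^sub>R w + t *\<^sub>R v) - \<phi> (x + t *\<^sub>R w) - \<phi> (x + t *\<^sub>R v) + \<phi> x) / t\<^sup>2) \<longlongrightarrow> D w)
    (at_right 0)"
proof -
  let ?\<Delta> = "\<lambda>t. \<phi> (x + t *\<^sub>R w + t *\<^sub>R v) - \<phi> (x + t *\<^sub>R w) - \<phi> (x + t *\<^sub>R v) + \<phi> x"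
  let ?rem = "\<lambda>h. pd \<phi> v (x + h) - pd \<phi> v x - D h"
  interpret D: linear D using D by (rule has_derivative_linear)
  obtain \<xi> where \<xi>: "\<forall>\<^sub>F t in at_right 0. 0 < \<xi> t \<and> \<xi> t < t \<and>
      ?\<Delta> t = t * (pd \<phi> v (x + t *\<^sub>R w + \<xi> t *\<^sub>R v) - pd \<phi> v (x + \<xi> t *\<^sub>R v))"
    using eventually_second_difference_mean_value[OF S \<phi>] unfolding eventually_ex by blast
  have "\<forall>\<^sub>F t in at_right 0. norm (t *\<^sub>R w + \<xi> t *\<^sub>R v) \<le> (norm w + norm v) * t"
    using \<xi> by eventually_elim (simp add: norm_add_scaleR_le)
  moreover have "\<forall>\<^sub>F t in at_right 0. norm (\<xi> t *\<^sub>R v) \<le> norm v * t"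
    using \<xi> by eventually_elim (simp add: mult.commute[of "norm v"] mult_right_mono)
  ultimately have "((\<lambda>t. ?rem (t *\<^sub>R w + \<xi> t *\<^sub>R v) /\<^sub>R t - ?rem (\<xi> t *\<^sub>R v) /\<^sub>R t + D w)
      \<longlongrightarrow> 0 - 0 + D w) (at_right 0)"
    by (intro tendsto_intros has_derivative_remainder_along[OF D])
  moreover have "\<forall>\<^sub>F t in at_right 0.
      ?rem (t *\<^sub>R w + \<xi> t *\<^sub>R v) /\<^sub>R t - ?rem (\<xi> t *\<^sub>R v) /\<^sub>R t + D w = ?\<Delta> t / t\<^sup>2"
    using \<xi> by eventually_elim (simp add: D.add D.scale field_simps power2_eq_square)
  ultimately have "((\<lambda>t. ?\<Delta> t / t\<^sup>2) \<longlongrightarrow> 0 - 0 + D w) (at_right 0)"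
    by (rule Lim_transform_eventually)
  then show ?thesis by simp
qed

lemma pd_commute:
  fixes \<phi> :: "'a::real_normed_vector \<Rightarrow> real"
  assumes S: "open S" "x \<in> S" and \<phi>: "\<And>y. y \<in> S \<Longrightarrow> \<phi> differentiable (at y)"
    and v: "pd \<phi> v differentiable (at x)" and w: "pd \<phi> w differentiable (at x)"
  shows "pd (pd \<phi> v) w x = pd (pd \<phi> w) v x"
proof -
  let ?\<Delta> = "\<lambda>v w t. (\<phi> (x + t *\<^sub>R w + t *\<^sub>R v) - \<phi> (x + t *\<^sub>R w) - \<phi> (x + t *\<^sub>R v) + \<phi> x) / t\<^sup>2"
  have "?\<Delta> v w = ?\<Delta> w v" by (simp add: fun_eq_iff add_ac)
  then show ?thesis
    using tendsto_unique[OF _ second_difference_tendsto[OF S \<phi> has_derivative_pd[OF v], of w]]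
      second_difference_tendsto[OF S \<phi> has_derivative_pd[OF w], of v]
    by simp
qed

lemma smooth_on_differentiable: "smooth_on S \<phi> \<Longrightarrow> a \<in> S \<Longrightarrow> \<phi> differentiable (at a)"
  unfolding smooth_on_def by (metis differentiable_on_eq_differentiable_at iter_pd.simps(1))

lemma iter_pd_append: "iter_pd g (vs @ ws) = iter_pd (iter_pd g ws) vs"
  by (induction vs) auto

lemma smooth_on_pd: "smooth_on S \<phi> \<Longrightarrow> smooth_on S (pd \<phi> v)"
  unfolding smooth_on_def using iter_pd_append[of \<phi> _ "[v]"] by (metis iter_pd.simps)

lemma smooth_on_pd_commute:
  assumes "smooth_on S \<phi>" "x \<in> S"
  shows "pd (pd \<phi> v) w x = pd (pd \<phi> w) v x"
proof (rule pd_commute)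
  show "open S" using assms(1) by (simp add: smooth_on_def)
qed (use assms in \<open>auto intro: smooth_on_differentiable smooth_on_pd\<close>)

subsection \<open>Volume data\<close>

lemma rho_eq_powr:
  obtains k where "rho vt n = (\<lambda>s. s powr k)"
  by (cases vt) (auto simp: rho_def fun_eq_iff)

lemma rho_pos: "s > 0 \<Longrightarrow> rho vt n s > 0"
  by (cases rule: rho_eq_powr[of vt n]) simp

lemma rho_has_real_derivative:
  assumes "s > 0"
  shows "(rho vt n has_real_derivative deriv (rho vt n) s) (at s)"
proof -
  obtain k where "rho vt n = (\<lambda>s. s powr k)" by (rule rho_eq_powr)
  then have "(rho vt n has_real_derivative k * s powr (k - 1)) (at s)"
    using has_real_derivative_powr[OF assms] by simp
  then show ?thesis by (simp add: DERIV_imp_deriv)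
qed

lemma deriv_rho_has_real_derivative:
  assumes "s > 0"
  shows "(deriv (rho vt n) has_real_derivative deriv (deriv (rho vt n)) s) (at s)"
proof -
  obtain k where rho: "rho vt n = (\<lambda>s. s powr k)" by (rule rho_eq_powr)
  have deriv_rho: "k * t powr (k - 1) = deriv (rho vt n) t" if "t > 0" for t
    using has_real_derivative_powr[OF that, of k] by (simp add: rho DERIV_imp_deriv)
  have "((\<lambda>t. k * t powr (k - 1)) has_real_derivative k * ((k - 1) * s powr (k - 1 - 1))) (at s)"
    by (rule DERIV_cmult[OF has_real_derivative_powr[OF assms]])
  then have "(deriv (rho vt n) has_real_derivative k * ((k - 1) * s powr (k - 1 - 1))) (at s)"
    by (rule has_field_derivative_transform_within_open[OF _ open_greaterThan])
      (use assms deriv_rho in auto)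
  then show ?thesis by (simp add: DERIV_imp_deriv)
qed

lemma chi_pos: "w < 1 \<Longrightarrow> chi vt n w > 0"
  by (simp add: chi_def split: volform.split)

lemma chi_has_real_derivative:
  assumes "w < 1"
  shows "(chi vt n has_real_derivative chi vt n w * deriv (\<lambda>w. ln (chi vt n w)) w) (at w)"
proof -
  obtain D where D: "(chi vt n has_real_derivative D) (at w)"
  proof (cases vt)
    case BH
    then have "chi vt n = (\<lambda>w. 1)" by (simp add: chi_def fun_eq_iff)
    then show ?thesis using that DERIV_const by metis
  next
    case HT
    then have "chi vt n = (\<lambda>w. (1 - w) powr ((real n + 1) / 2))" by (simp add: chi_def fun_eq_iff)
    moreover have "((\<lambda>w. (1 - w) powr ((real n + 1) / 2)) has_real_derivative
        - ((real n + 1) / 2) * (1 - w) powr ((real n + 1) / 2 - 1)) (at w)"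
      using assms by (auto intro!: derivative_eq_intros simp: powr_diff)
    ultimately show ?thesis using that by metis
  qed
  have "deriv (\<lambda>w. ln (chi vt n w)) w = inverse (chi vt n w) * D"
    by (rule DERIV_imp_deriv[OF DERIV_chain2[OF DERIV_ln[OF chi_pos[OF assms]] D]])
  then show ?thesis using D chi_pos[OF assms, of vt n] by (simp add: mult.assoc[symmetric])
qed

subsection \<open>The Levi-Civita connection\<close>

definition connection :: "(real^'k \<Rightarrow> real^'k^'k) \<Rightarrow> real^'k \<Rightarrow> real^'k \<Rightarrow> real^'k^'k" where
  "connection g y v = (\<chi> a b. \<Sum>e\<in>UNIV. christoffel g y a e b * v $ e)"

lemma connection_axis: "connection g y (axis e 1) $ a $ b = christoffel g y a e b"
  by (simp add: connection_def axis_def if_distrib cong: if_cong)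

lemma dx_vec_nth:
  assumes "(X has_derivative D) (at y)"
  shows "dx (\<lambda>u. X u $ a) e y = D (axis e 1) $ a"
  unfolding dx_def by (rule pd_eq) (rule derivative_intros assms)+

lemma dx_matrix_nth:
  assumes "(g has_derivative D) (at y)"
  shows "dx (\<lambda>u. g u $ a $ b) e y = D (axis e 1) $ a $ b"
  unfolding dx_def by (rule pd_eq) (rule derivative_intros assms)+

lemma linear_axis_expansion:
  fixes F :: "real^'k \<Rightarrow> 'b::real_vector"
  assumes "linear F"
  shows "F v = (\<Sum>e\<in>UNIV. v $ e *\<^sub>R F (axis e 1))"
proof -
  have "F v = F (\<Sum>e\<in>UNIV. v $ e *\<^sub>R axis e 1)" by (simp only: sum_scaleR_axis)
  then show ?thesis by (simp add: linear_sum[OF assms] linear_scale[OF assms])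
qed

locale metric_germ =
  fixes g :: "real^'k \<Rightarrow> real^'k^'k" and y :: "real^'k" and D
  assumes g': "(g has_derivative D) (at y)" and sym: "transpose (g y) = g y"
    and inv: "invertible (g y)" and sym_D: "\<And>v. transpose (D v) = D v"
begin

lemma inner_D: "x \<bullet> (D v *v w) = w \<bullet> (D v *v x)"
  by (metis inner_commute inner_matrix_vector_transpose sym_D)

lemma lower_connection_axis:
  "(g y *v (connection g y (axis e 1) *v axis b 1)) $ a =
     (D (axis e 1) $ a $ b + D (axis b 1) $ a $ e - D (axis a 1) $ e $ b) / 2"
proof -
  define lower where
    "lower = (\<chi> d. (D (axis e 1) $ d $ b + D (axis b 1) $ d $ e - D (axis d 1) $ e $ b) / 2)"
  have "(connection g y (axis e 1) *v axis b 1) $ d = christoffel g y d e b" for d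
    by (simp add: matrix_vector_mult_axis connection_axis)
  then have "connection g y (axis e 1) *v axis b 1 = matrix_inv (g y) *v lower"
    by (simp add: vec_eq_iff christoffel_def dx_matrix_nth[OF g'] lower_def matrix_vector_mult_def
        sum_divide_distrib)
  then have "g y *v (connection g y (axis e 1) *v axis b 1) = lower"
    by (simp add: matrix_vector_mul_assoc matrix_inv_right inv matrix_mul_assoc)
  then show ?thesis by (simp add: lower_def)
qed

lemma linear_D: "linear D"
  by (rule has_derivative_linear[OF g'])

lemma koszul_axis:
  "x \<bullet> (g y *v (connection g y (axis e 1) *v axis b 1)) =
     (x \<bullet> (D (axis e 1) *v axis b 1) + x \<bullet> (D (axis b 1) *v axis e 1)
       - axis e 1 \<bullet> (D x *v axis b 1)) / 2"
proof -
  have "axis e 1 \<bullet> (D x *v axis b 1) = (\<Sum>a\<in>UNIV. x $ a * D (axis a 1) $ e $ b)"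
    by (simp add: inner_axis' matrix_vector_mult_axis linear_axis_expansion[OF linear_D, of x])
  then show ?thesis
    by (simp add: inner_vec_def[of x] lower_connection_axis matrix_vector_mult_axis sum.distrib
        sum_subtractf algebra_simps flip: sum_divide_distrib)
qed

lemma koszul:
  "x \<bullet> (g y *v (connection g y v *v w)) =
     (x \<bullet> (D v *v w) + x \<bullet> (D w *v v) - v \<bullet> (D x *v w)) / 2"
proof -
  have connection_linear: "connection g y (a + b) = connection g y a + connection g y b"
    "connection g y (r *\<^sub>R a) = r *\<^sub>R connection g y a" for a b r
    by (simp_all add: connection_def vec_eq_iff sum.distrib sum_distrib_left algebra_simps)
  let ?lhs = "\<lambda>v w. x \<bullet> (g y *v (connection g y v *v w))"
  let ?rhs = "\<lambda>v w. (x \<bullet> (D v *v w) + x \<bullet> (D w *v v) - v \<bullet> (D x *v w)) / 2"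
  have "?lhs = ?rhs"
  proof (rule bilinear_eq_stdbasis)
    show "bilinear ?lhs" "bilinear ?rhs"
      by (simp_all add: bilinear_def linear_iff connection_linear matrix_normalize inner_simps
          linear_add[OF linear_D] linear_scale[OF linear_D] algebra_simps add_divide_distrib
          diff_divide_distrib)
  qed (auto simp: Basis_vec_def koszul_axis)
  then show ?thesis by meson
qed

lemma connection_commute: "connection g y v *v w = connection g y w *v v"
proof -
  have "x \<bullet> (g y *v (connection g y v *v w)) = x \<bullet> (g y *v (connection g y w *v v))" for x
    unfolding koszul using inner_D[of v x w] by simp
  then have "g y *v (connection g y v *v w) = g y *v (connection g y w *v v)"
    using vector_eq_ldot by blast
  then show ?thesis
    using inj_matrix_vector_mult[OF inv] by (auto dest: injD)
qed

lemma metric_compatible: "D v = g y ** connection g y v + transpose (connection g y v) ** g y"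
proof (rule matrix_eqI_inner)
  fix x w
  let ?C = "connection g y v"
  have "x \<bullet> (transpose ?C *v (g y *v w)) = (?C *v x) \<bullet> (g y *v w)"
    by (simp add: inner_matrix_vector_transpose)
  also have "\<dots> = w \<bullet> (g y *v (?C *v x))"
    by (metis inner_commute inner_matrix_vector_transpose sym)
  finally have "x \<bullet> (g y *v (?C *v w)) + x \<bullet> (transpose ?C *v (g y *v w)) = x \<bullet> (D v *v w)"
    using inner_D[of x v w] inner_D[of w x v] inner_D[of x w v] by (simp add: koszul field_simps)
  then show "x \<bullet> (D v *v w) = x \<bullet> ((g y ** ?C + transpose ?C ** g y) *v w)"
    by (simp add: matrix_vector_mult.add_left matrix_vector_mul_assoc inner_add_right)
qed

lemma metric_has_derivative:
  "(g has_derivative (\<lambda>v. g y ** connection g y v + transpose (connection g y v) ** g y)) (at y)"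
  using g' by (simp add: metric_compatible[abs_def, symmetric])

end

subsection \<open>Killing navigation data\<close>

definition low :: "(real^'m \<Rightarrow> real^'m^'m) \<Rightarrow> (real^'m \<Rightarrow> real^'m) \<Rightarrow> real^'m \<Rightarrow> real^'m" where
  "low g W y = g y *v W y"

definition cov_mat :: "(real^'m \<Rightarrow> real^'m^'m) \<Rightarrow> (real^'m \<Rightarrow> real^'m) \<Rightarrow> real^'m \<Rightarrow> real^'m^'m" where
  "cov_mat g W y = (\<chi> a e. covWl g W y a e)"

definition grad_nrm2 :: "(real^'m \<Rightarrow> real^'m^'m) \<Rightarrow> (real^'m \<Rightarrow> real^'m) \<Rightarrow> real^'m \<Rightarrow> real^'m" where
  "grad_nrm2 g W y = 2 *\<^sub>R (transpose (cov_mat g W y) *v W y)"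

lemma lowW_eq: "lowW g W y a = low g W y $ a"
  by (simp add: lowW_def low_def matrix_vector_mult_def)

lemma nrm2_eq: "nrm2 g W y = W y \<bullet> low g W y"
  by (simp add: nrm2_def low_def matrix_vector_mult_def inner_vec_def sum_distrib_left mult_ac)

lemma frak_s_eq: "frak_s g W y z = navigation_s (g y) z (low g W y) (nrm2 g W y)"
proof -
  define v where "v = transpose z *v low g W y"
  have v: "(\<Sum>a\<in>UNIV. lowW g W y a * z $ a $ i) = v $ i" for i
    by (simp add: v_def lowW_eq matrix_vector_mult_def transpose_def mult.commute)
  have "(\<Sum>i\<in>UNIV. \<Sum>j\<in>UNIV. matrix_inv (hmat (g y) z) $ i $ j * v $ i * v $ j) =
      v \<bullet> (cometric (g y) z *v v)"
    by (simp add: cometric_def inner_vec_def matrix_vector_mult_def sum_distrib_left mult_ac)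
  also have "\<dots> = low g W y \<bullet> (z *v tangent_part (g y) z (low g W y))"
    by (simp add: v_def inner_matrix_vector_transpose tangent_part_def Amat_def
        matrix_vector_mul_assoc)
  finally show ?thesis unfolding frak_s_def navigation_s_def v by simp
qed

lemma Fcal_eq:
  fixes z :: "real^'n^'m"
  shows "Fcal vt g W (y, z) = vol_density (chi vt CARD('n)) (g y) z (nrm2 g W y)
    * rho vt CARD('n) (navigation_s (g y) z (low g W y) (nrm2 g W y))"
  by (simp add: Fcal_def frak_s_eq vol_density_def)

locale killing_navigation =
  fixes V :: "(real^'m) set" and g :: "real^'m \<Rightarrow> real^'m^'m" and W :: "real^'m \<Rightarrow> real^'m"
  assumes riemannian: "riemannian_on V g" and smooth_W: "\<And>a. smooth_on V (\<lambda>y. W y $ a)"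
    and small: "\<And>y. y \<in> V \<Longrightarrow> nrm2 g W y < 1" and killing: "killing_on V g W"
begin

lemma smooth_metric: "smooth_on V (\<lambda>y. g y $ a $ b)"
  using riemannian by (simp add: riemannian_on_def)

lemma open_domain: "open V"
  using smooth_metric unfolding smooth_on_def by blast

lemma positive_definite_metric: "y \<in> V \<Longrightarrow> positive_definite (g y)"
  using riemannian
  by (simp add: riemannian_on_def positive_definite_def transpose_def vec_eq_iff
      matrix_vector_mult_def inner_vec_def sum_distrib_left mult_ac)

lemma differentiable_metric: "y \<in> V \<Longrightarrow> g differentiable (at y)"
  by (intro differentiable_vec_componentwise) (rule smooth_on_differentiable[OF smooth_metric])

lemma differentiable_W: "y \<in> V \<Longrightarrow> W differentiable (at y)"
  by (intro differentiable_vec_componentwise) (rule smooth_on_differentiable[OF smooth_W])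

lemma metric_germ:
  assumes y: "y \<in> V"
  shows "metric_germ g y (frechet_derivative g (at y))"
proof
  show g': "(g has_derivative frechet_derivative g (at y)) (at y)"
    using differentiable_metric[OF y] frechet_derivative_works by blast
  show "transpose (g y) = g y" "invertible (g y)"
    using positive_definite_metric[OF y]
    by (simp_all add: invertible_positive_definite) (simp add: positive_definite_def)
  fix v
  have "((\<lambda>y. transpose (g y)) has_derivative frechet_derivative g (at y)) (at y)"
    by (rule has_derivative_transform_within_open[OF g' open_domain y])
      (simp add: positive_definite_metric positive_definite_def[THEN iffD1, THEN conjunct1])
  then show "transpose (frechet_derivative g (at y) v) = frechet_derivative g (at y) v"
    using has_derivative_unique[OF bounded_linear.has_derivative[OF bounded_linear_transpose g']]
    by metis
qed

lemma cov_mat_mult_vec: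
  assumes y: "y \<in> V" and J: "(W has_derivative J) (at y)"
  shows "cov_mat g W y *v v = g y *v (J v + connection g y v *v W y)"
proof -
  interpret metric_germ g y "frechet_derivative g (at y)" by (rule metric_germ[OF y])
  have "covW g W y b e = (J (axis e 1) + connection g y (W y) *v axis e 1) $ b" for b e
    unfolding connection_commute[of "W y"]
    by (simp add: covW_def dx_vec_nth[OF J] matrix_vector_mult_def connection_axis)
  then have "cov_mat g W y *v axis e 1 =
      g y *v (J (axis e 1) + connection g y (W y) *v axis e 1)" for e
    unfolding vec_eq_iff matrix_vector_mult_def[of "g y"]
    by (simp add: matrix_vector_mult_axis cov_mat_def covWl_def)
  then have "(\<lambda>v. cov_mat g W y *v v) = (\<lambda>v. g y *v (J v + connection g y (W y) *v v))"
    using has_derivative_linear[OF J]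
    by (intro linear_eq_stdbasis linear_compose_add) (auto simp: Basis_vec_def intro!: linearI
        simp: matrix_normalize linear_add linear_scale algebra_simps)
  then show ?thesis by (metis connection_commute)
qed

lemma low_has_derivative:
  assumes y: "y \<in> V"
  shows "(low g W has_derivative
    (\<lambda>v. cov_mat g W y *v v + transpose (connection g y v) *v low g W y)) (at y)"
proof -
  interpret metric_germ g y "frechet_derivative g (at y)" by (rule metric_germ[OF y])
  obtain J where J: "(W has_derivative J) (at y)"
    using differentiable_W[OF y] by (auto simp: differentiable_def)
  have "((\<lambda>y. g y *v W y) has_derivative (\<lambda>v. g y *v J v
      + (g y ** connection g y v + transpose (connection g y v) ** g y) *v W y)) (at y)"
    by (rule matrix_vector_mult.FDERIV[OF metric_has_derivative J])
  then show ?thesis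
    by (simp add: low_def[abs_def] cov_mat_mult_vec[OF y J] matrix_normalize algebra_simps)
qed

lemma nrm2_has_derivative:
  assumes y: "y \<in> V"
  shows "(nrm2 g W has_derivative (\<lambda>v. grad_nrm2 g W y \<bullet> v)) (at y)"
proof -
  interpret metric_germ g y "frechet_derivative g (at y)" by (rule metric_germ[OF y])
  obtain J where J: "(W has_derivative J) (at y)"
    using differentiable_W[OF y] by (auto simp: differentiable_def)
  have "W y \<bullet> (g y *v x) = x \<bullet> low g W y" for x
    using inner_matrix_vector_transpose[of "g y" "W y" x] by (simp add: low_def sym inner_commute)
  then have "W y \<bullet> (cov_mat g W y *v v) =
      J v \<bullet> low g W y + W y \<bullet> (transpose (connection g y v) *v low g W y)" for v
    by (simp add: cov_mat_mult_vec[OF y J] inner_add_left inner_matrix_vector_transpose)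
  moreover have "grad_nrm2 g W y \<bullet> v = 2 * (W y \<bullet> (cov_mat g W y *v v))" for v
    by (simp add: grad_nrm2_def inner_matrix_vector_transpose)
  ultimately show ?thesis
    unfolding nrm2_eq
    by (intro has_derivative_eq_rhs[OF has_derivative_inner[OF J low_has_derivative[OF y]]])
      (simp add: fun_eq_iff inner_add_right)
qed

lemma cov_mat_skew:
  assumes y: "y \<in> V"
  shows "transpose (cov_mat g W y) = - cov_mat g W y"
proof -
  interpret metric_germ g y "frechet_derivative g (at y)" by (rule metric_germ[OF y])
  obtain J where J: "(W has_derivative J) (at y)"
    using differentiable_W[OF y] by (auto simp: differentiable_def)
  let ?D = "frechet_derivative g (at y)" and ?J = "matrix J"
  have J_mult: "?J *v v = J v" for v
    using matrix_vector_mul(2)[OF has_derivative_linear[OF J]] by metis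
  have lie: "?D (W y) + (transpose ?J ** g y + g y ** ?J) = 0"
  proof -
    have "?D (W y) $ a $ b = (\<Sum>d\<in>UNIV. W y $ d * dx (\<lambda>u. g u $ a $ b) d y)" for a b
      by (simp add: dx_matrix_nth[OF g'] linear_axis_expansion[OF linear_D, of "W y"])
    moreover have "?J $ d $ e = dx (\<lambda>u. W u $ d) e y" for d e
      by (simp add: dx_vec_nth[OF J] matrix_def)
    ultimately show ?thesis
      using killing y
      by (simp add: killing_on_def vec_eq_iff matrix_matrix_mult_def transpose_def sum.distrib
          mult.commute add.assoc)
  qed
  have "cov_mat g W y = g y ** ?J + g y ** connection g y (W y)"
    unfolding matrix_eq
    by (simp add: cov_mat_mult_vec[OF y J] matrix_vector_mult.add_left matrix_vector_mult.add_right
        J_mult connection_commute[of _ "W y"] flip: matrix_vector_mul_assoc)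
  then have "transpose (cov_mat g W y) + cov_mat g W y =
      ?D (W y) + (transpose ?J ** g y + g y ** ?J)"
    by (simp add: metric_compatible[of "W y"] matrix_normalize sym)
  then show ?thesis unfolding lie by (rule eq_neg_iff_add_eq_0[THEN iffD2])
qed

end

subsection \<open>Derivatives of the integrand\<close>

definition rho_deriv ::
    "nat \<Rightarrow> volform \<Rightarrow> (real^'m \<Rightarrow> real^'m^'m) \<Rightarrow> (real^'m \<Rightarrow> real^'m) \<Rightarrow> real^'m \<Rightarrow> real^'n^'m \<Rightarrow>
      real" where
  "rho_deriv k vt g W y z = (deriv ^^ k) (rho vt CARD('n)) (frak_s g W y z)"

definition log_chi_deriv :: "volform \<Rightarrow> nat \<Rightarrow> real \<Rightarrow> real" where
  "log_chi_deriv vt n w = deriv (\<lambda>w. ln (chi vt n w)) w"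

definition Fcal_vol ::
    "volform \<Rightarrow> (real^'m \<Rightarrow> real^'m^'m) \<Rightarrow> (real^'m \<Rightarrow> real^'m) \<Rightarrow> real^'m \<Rightarrow> real^'n^'m \<Rightarrow> real" where
  "Fcal_vol vt g W y z = vol_density (chi vt CARD('n)) (g y) z (nrm2 g W y)"

definition jet_velocity ::
    "(real^'m \<Rightarrow> real^'m^'m) \<Rightarrow> (real^'m \<Rightarrow> real^'m) \<Rightarrow> real^'m \<Rightarrow> (real^'m) \<times> (real^'n^'m) \<Rightarrow>
      (real^'m^'m) \<times> (real^'m) \<times> real \<times> (real^'n^'m)" where
  "jet_velocity g W y = (\<lambda>(v, Z).
     (g y ** connection g y v + transpose (connection g y v) ** g y,
      cov_mat g W y *v v + transpose (connection g y v) *v low g W y, grad_nrm2 g W y \<bullet> v, Z))"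

lemma Fcal_eq_rho_deriv: "Fcal vt g W (y, z) = Fcal_vol vt g W y z * rho_deriv 0 vt g W y z"
  by (simp add: Fcal_eq Fcal_vol_def rho_deriv_def frak_s_eq)

lemma jet_velocity_frame: "jet_velocity g W y (0, Z) = (0, 0, 0, Z)"
proof -
  have "connection g y 0 = 0" by (simp add: connection_def vec_eq_iff)
  then show ?thesis by (simp add: jet_velocity_def matrix_normalize)
qed

context killing_navigation
begin

lemma frame_metric: "y \<in> V \<Longrightarrow> inj ((*v) z) \<Longrightarrow> frame (g y) z"
  using positive_definite_metric by unfold_locales

lemma frak_s_pos:
  assumes "y \<in> V" "inj ((*v) z)"
  shows "frak_s g W y z > 0"
proof -
  interpret frame "g y" z using assms by (rule frame_metric)
  show ?thesis
    using small[OF assms(1)] inner_tangent_part_nonneg[of "low g W y"]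
    by (simp add: frak_s_eq navigation_s_def)
qed

lemma rho_deriv_pos: "y \<in> V \<Longrightarrow> inj ((*v) z) \<Longrightarrow> rho_deriv 0 vt g W y z > 0"
  by (simp add: rho_deriv_def rho_pos frak_s_pos)

lemma Fcal_vol_pos:
  assumes "y \<in> V" "inj ((*v) z)"
  shows "Fcal_vol vt g W y z > 0"
proof -
  interpret frame "g y" z using assms by (rule frame_metric)
  show ?thesis
    using det_induced chi_pos[OF small[OF assms(1)]] by (simp add: Fcal_vol_def vol_density_def)
qed

lemma variation_at_jet:
  assumes y: "y \<in> V" and z: "inj ((*v) z)"
  shows "variation (\<lambda>q. g (fst q)) snd (\<lambda>q. low g W (fst q)) (\<lambda>q. nrm2 g W (fst q))
    (\<lambda>h. g y ** connection g y (fst h) + transpose (connection g y (fst h)) ** g y) snd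
    (\<lambda>h. cov_mat g W y *v fst h + transpose (connection g y (fst h)) *v low g W y)
    (\<lambda>h. grad_nrm2 g W y \<bullet> fst h) (y, z)"
proof (rule variation.intro)
  interpret metric_germ g y "frechet_derivative g (at y)" by (rule metric_germ[OF y])
  have fst: "(fst has_derivative fst) (at (y, z))"
    by (rule bounded_linear_imp_has_derivative[OF bounded_linear_fst])
  note compose = has_derivative_compose[OF fst, unfolded fst_conv]
  show "((\<lambda>q. g (fst q)) has_derivative
      (\<lambda>h. g y ** connection g y (fst h) + transpose (connection g y (fst h)) ** g y)) (at (y, z))"
    by (rule compose[OF metric_has_derivative])
  show "((\<lambda>q. low g W (fst q)) has_derivative
      (\<lambda>h. cov_mat g W y *v fst h + transpose (connection g y (fst h)) *v low g W y)) (at (y, z))"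
    by (rule compose[OF low_has_derivative[OF y]])
  show "((\<lambda>q. nrm2 g W (fst q)) has_derivative (\<lambda>h. grad_nrm2 g W y \<bullet> fst h)) (at (y, z))"
    by (rule compose[OF nrm2_has_derivative[OF y]])
  show "(snd has_derivative snd) (at (y, z))"
    by (rule bounded_linear_imp_has_derivative[OF bounded_linear_snd])
  show "frame (g (fst (y, z))) (snd (y, z))"
    using frame_metric[OF y z] by simp
qed

lemma
  fixes z :: "real^'n^'m" and vt :: volform
  assumes y: "y \<in> V" and z: "inj ((*v) z)"
  defines "r0 \<equiv> rho_deriv 0 vt g W y z" and "r1 \<equiv> rho_deriv 1 vt g W y z"
    and "r2 \<equiv> rho_deriv 2 vt g W y z" and "L \<equiv> log_chi_deriv vt CARD('n) (nrm2 g W y)"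
  shows Fcal_has_derivative: "(Fcal vt g W has_derivative (\<lambda>h. Fcal_vol vt g W y z
      * var_integrand r0 r1 L (g y) z (low g W y) (jet_velocity g W y h))) (at (y, z))"
      (is ?integrand)
    and Fcal_momentum_has_derivative: "((\<lambda>(y, z). Fcal_vol vt g W y z
      * momentum (rho_deriv 0 vt g W y z) (rho_deriv 1 vt g W y z) (g y) z (low g W y) Y)
      has_derivative (\<lambda>h. Fcal_vol vt g W y z
        * var_momentum r0 r1 r2 L (g y) z (low g W y) (jet_velocity g W y h) Y)) (at (y, z))"
      (is ?momentum)
proof -
  interpret variation "\<lambda>q. g (fst q)" snd "\<lambda>q. low g W (fst q)" "\<lambda>q. nrm2 g W (fst q)"
    "\<lambda>h. g y ** connection g y (fst h) + transpose (connection g y (fst h)) ** g y" snd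
    "\<lambda>h. cov_mat g W y *v fst h + transpose (connection g y (fst h)) *v low g W y"
    "\<lambda>h. grad_nrm2 g W y \<bullet> fst h" "(y, z)"
    by (rule variation_at_jet[OF y z])
  let ?s = "\<lambda>q :: (real^'m) \<times> (real^'n^'m).
    navigation_s (g (fst q)) (snd q) (low g W (fst q)) (nrm2 g W (fst q))"
  let ?w = "nrm2 g W (fst (y, z))"
  have chi': "(chi vt CARD('n) has_real_derivative chi vt CARD('n) ?w * L) (at ?w)"
    and chi: "chi vt CARD('n) ?w > 0"
    using chi_has_real_derivative[OF small[OF y]] chi_pos[OF small[OF y]]
    by (simp_all add: L_def log_chi_deriv_def)
  note rho' = rho_has_real_derivative[OF frak_s_pos[OF y z], of vt "CARD('n)"]
    and rho'' = deriv_rho_has_real_derivative[OF frak_s_pos[OF y z], of vt "CARD('n)"]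
  have s: "frak_s g W y z = ?s (y, z)"
    by (simp add: frak_s_eq)
  have Fcal: "Fcal vt g W = (\<lambda>q.
      vol_density (chi vt CARD('n)) (g (fst q)) (snd q) (nrm2 g W (fst q)) * rho vt CARD('n) (?s q))"
    by (auto simp: fun_eq_iff Fcal_eq)
  show ?integrand
    unfolding Fcal using integrand_has_derivative[OF chi' chi s rho']
    by (simp add: Fcal_vol_def jet_velocity_def case_prod_unfold r0_def r1_def rho_deriv_def)
  show ?momentum
    using momentum_has_derivative[OF chi' chi s rho' rho'']
    by (simp add: Fcal_vol_def jet_velocity_def case_prod_unfold r0_def r1_def r2_def rho_deriv_def
        frak_s_eq numeral_2_eq_2)
qed

lemma pd_Fcal_frame:
  assumes "y \<in> V" "inj ((*v) z)"
  shows "pd (Fcal vt g W) (0, Y) (y, z) = Fcal_vol vt g W y z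
    * momentum (rho_deriv 0 vt g W y z) (rho_deriv 1 vt g W y z) (g y) z (low g W y) Y"
  using pd_eq[OF Fcal_has_derivative[OF assms]]
  by (simp add: jet_velocity_frame var_integrand_frame)

lemma open_jet_domain: "open (V \<times> {z :: real^'n^'m. inj ((*v) z)})"
  by (intro open_Times open_domain open_inj_matrix)

lemma pd_Fcal_frame_has_derivative:
  fixes z :: "real^'n^'m"
  assumes y: "y \<in> V" and z: "inj ((*v) z)"
  shows "(pd (Fcal vt g W) (0, Y) has_derivative (\<lambda>h. Fcal_vol vt g W y z
    * var_momentum (rho_deriv 0 vt g W y z) (rho_deriv 1 vt g W y z) (rho_deriv 2 vt g W y z)
        (log_chi_deriv vt CARD('n) (nrm2 g W y)) (g y) z (low g W y) (jet_velocity g W y h) Y))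
    (at (y, z))"
  by (rule has_derivative_transform_within_open[
        OF Fcal_momentum_has_derivative[OF y z] open_jet_domain])
    (use assms in \<open>auto simp: pd_Fcal_frame\<close>)

end

subsection \<open>The mean curvature form as an Euler-Lagrange expression\<close>

definition hess :: "(real^'n \<Rightarrow> real^'m) \<Rightarrow> real^'n \<Rightarrow> 'n::finite \<Rightarrow> real^'n^'m" where
  "hess f x i = (\<chi> a j. d2f f x a i j)"

lemma sum_scaleR_dirX: "(\<Sum>e\<in>UNIV. v $ e *\<^sub>R dirX e) = (v, 0)"
  by (simp add: dirX_def scaleR_Pair sum_prod sum_scaleR_axis)

lemma sum_scaleR_dirZ: "(\<Sum>j\<in>UNIV. \<Sum>e\<in>UNIV. M $ e $ j *\<^sub>R dirZ e j) = (0, M)"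
proof -
  have "(\<Sum>j\<in>UNIV. \<Sum>e\<in>UNIV. M $ e $ j *\<^sub>R axis e (axis j 1)) =
      (\<Sum>j\<in>UNIV. outer (M *v axis j 1) (axis j 1))"
    unfolding axis_axis_eq_outer
    by (simp add: sum_scaleR_axis flip: outer.scaleR_left outer.sum_left matrix_vector_mult_axis)
  then show ?thesis
    by (simp add: dirZ_def scaleR_Pair sum_prod sum_outer_axis)
qed

lemma meancurv_eq_euler_lagrange:
  fixes f :: "real^'n \<Rightarrow> real^'m" and vt g W x
  defines "F \<equiv> Fcal vt g W" and "q \<equiv> (f x, Dfz f x)"
  assumes S: "open S" "q \<in> S" and F: "\<And>r. r \<in> S \<Longrightarrow> F differentiable (at r)"
    and F': "\<And>Y. pd F (0, Y) differentiable (at q)"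
  shows "meancurv vt g W f x c =
    (pd F (dirX c) q - (\<Sum>i\<in>UNIV. pd (pd F (dirZ c i)) (Dfz f x *v axis i 1, hess f x i) q)) / F q"
proof -
  have "(\<Sum>j\<in>UNIV. \<Sum>e\<in>UNIV. pd (pd F (dirZ e j)) (dirZ c i) q * d2f f x e i j)
      + (\<Sum>e\<in>UNIV. pd (pd F (dirZ c i)) (dirX e) q * Dfz f x $ e $ i)
      = pd (pd F (dirZ c i)) (Dfz f x *v axis i 1, hess f x i) q" for i
  proof -
    let ?D = "\<lambda>h. pd (pd F (dirZ c i)) h q"
    have dirZ: "pd F (dirZ e j) differentiable (at q)" for e j
      unfolding dirZ_def by (rule F')
    interpret D: linear ?D
      using has_derivative_pd[OF dirZ] by (rule has_derivative_linear)
    have "pd (pd F (dirZ e j)) (dirZ c i) q = ?D (dirZ e j)" for e j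
      by (rule pd_commute[OF S F dirZ dirZ])
    then have "(\<Sum>j\<in>UNIV. \<Sum>e\<in>UNIV. pd (pd F (dirZ e j)) (dirZ c i) q * d2f f x e i j) =
        ?D (\<Sum>j\<in>UNIV. \<Sum>e\<in>UNIV. hess f x i $ e $ j *\<^sub>R dirZ e j)"
      by (simp add: D.sum D.scale hess_def mult.commute)
    moreover have "(\<Sum>e\<in>UNIV. ?D (dirX e) * Dfz f x $ e $ i) =
        ?D (\<Sum>e\<in>UNIV. (Dfz f x *v axis i 1) $ e *\<^sub>R dirX e)"
      by (simp add: D.sum D.scale matrix_vector_mult_axis mult.commute)
    ultimately show ?thesis
      by (simp add: sum_scaleR_dirX sum_scaleR_dirZ flip: D.add)
  qed
  then show ?thesis
    unfolding meancurv_def Let_def F_def[symmetric] q_def[symmetric]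
    by (simp add: diff_diff_eq sum.distrib[symmetric])
qed

subsection \<open>The second fundamental form\<close>

definition induced_metric ::
    "(real^'m \<Rightarrow> real^'m^'m) \<Rightarrow> (real^'n \<Rightarrow> real^'m) \<Rightarrow> real^'n \<Rightarrow> real^'n^'n" where
  "induced_metric g f u = hmat (g (f u)) (Dfz f u)"

definition sff_mat ::
    "(real^'m \<Rightarrow> real^'m^'m) \<Rightarrow> (real^'n \<Rightarrow> real^'m) \<Rightarrow> real^'n \<Rightarrow> 'n::finite \<Rightarrow> real^'n^'m" where
  "sff_mat g f x i = (\<chi> a j. sff g f x a i j)"

locale immersion_in_navigation = killing_navigation V g W
  for V :: "(real^'m) set" and g W +
  fixes U :: "(real^'n) set" and f :: "real^'n \<Rightarrow> real^'m" and x :: "real^'n"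
  assumes smooth_f: "\<And>a. smooth_on U (\<lambda>u. f u $ a)" and x: "x \<in> U" and fx: "f x \<in> V"
    and inj_Dfz: "inj ((*v) (Dfz f x))"
begin

abbreviation "y \<equiv> f x"
abbreviation "z \<equiv> Dfz f x"
abbreviation "D2f \<equiv> frechet_derivative (Dfz f) (at x)"

sublocale frame "g y" z
  by (rule frame_metric[OF fx inj_Dfz])

sublocale ambient: metric_germ g y "frechet_derivative g (at y)"
  by (rule metric_germ[OF fx])

lemma f_has_derivative: "(f has_derivative (*v) z) (at x)"
proof -
  obtain D where D: "(f has_derivative D) (at x)"
    using differentiable_vec_componentwise[of f x UNIV, OF smooth_on_differentiable[OF smooth_f x]]
    by (auto simp: differentiable_def)
  have "D (axis i 1) = z *v axis i 1" for i
    by (simp add: vec_eq_iff matrix_vector_mult_axis Dfz_def dx_vec_nth[OF D])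
  then have "D v = z *v v" for v
    using linear_axis_expansion[OF has_derivative_linear[OF D], of v]
      linear_axis_expansion[of "(*v) z" v] by simp
  then have "D = (*v) z" by blast
  with D show ?thesis by simp
qed

lemma Dfz_has_derivative: "(Dfz f has_derivative D2f) (at x)"
proof -
  have "(\<lambda>u. Dfz f u $ a $ j) differentiable (at x)" for a j
    unfolding Dfz_def using smooth_on_differentiable[OF smooth_on_pd[OF smooth_f] x]
    by (simp add: dx_def)
  then have "Dfz f differentiable (at x)"
    by (intro differentiable_vec_componentwise)
  then show ?thesis using frechet_derivative_works by blast
qed

lemma D2f_axis: "D2f (axis i 1) = hess f x i"
  using dx_matrix_nth[OF Dfz_has_derivative, symmetric]
  by (simp add: vec_eq_iff hess_def d2f_def Dfz_def)

lemma D2f_commute: "D2f v *v w = D2f w *v v"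
proof -
  note linear = has_derivative_linear[OF Dfz_has_derivative]
  have "hess f x i *v axis j 1 = hess f x j *v axis i 1" for i j
    using smooth_on_pd_commute[OF smooth_f x]
    by (simp add: vec_eq_iff matrix_vector_mult_axis hess_def d2f_def dx_def)
  then have "(\<lambda>v w. D2f v *v w) = (\<lambda>v w. D2f w *v v)"
    by (intro bilinear_eq_stdbasis)
      (auto simp: bilinear_def linear_iff linear_add[OF linear] linear_scale[OF linear]
        matrix_normalize Basis_vec_def D2f_axis)
  then show ?thesis by meson
qed

definition covariant_hess :: "real^'n \<Rightarrow> real^'n^'m" where
  "covariant_hess v = D2f v + connection g y (z *v v) ** z"

lemma covariant_hess_commute: "covariant_hess v *v w = covariant_hess w *v v"
  using D2f_commute[of v w] ambient.connection_commute[of "z *v v" "z *v w"]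
  by (simp add: covariant_hess_def matrix_normalize)

lemma induced_metric_has_derivative:
  "(induced_metric g f has_derivative (\<lambda>v. transpose (covariant_hess v) ** (g y ** z)
     + transpose z ** (g y ** covariant_hess v))) (at x)"
proof -
  have g_f: "((\<lambda>u. g (f u)) has_derivative (\<lambda>v. g y ** connection g y (z *v v)
      + transpose (connection g y (z *v v)) ** g y)) (at x)"
    by (rule has_derivative_compose[OF f_has_derivative ambient.metric_has_derivative])
  show ?thesis
    unfolding induced_metric_def[abs_def] hmat_eq
    by (rule has_derivative_eq_rhs, (rule matrix_has_derivative g_f Dfz_has_derivative)+)
      (simp add: fun_eq_iff covariant_hess_def matrix_normalize algebra_simps)
qed

sublocale induced: metric_germ "induced_metric g f" x
  "\<lambda>v. transpose (covariant_hess v) ** (g y ** z) + transpose z ** (g y ** covariant_hess v)"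
  using induced_metric_has_derivative positive_definite_induced invertible_induced
  by unfold_locales
    (auto simp: induced_metric_def positive_definite_def matrix_normalize transpose_metric
      add.commute)

lemma lower_induced_connection:
  "induced_metric g f x ** connection (induced_metric g f) x v =
     transpose z ** (g y ** covariant_hess v)"
proof (rule matrix_eqI_inner)
  fix a b
  let ?N = covariant_hess
  have expand: "a \<bullet> ((transpose (?N v) ** (g y ** z) + transpose z ** (g y ** ?N v)) *v b) =
      (?N v *v a) \<bullet> (g y *v (z *v b)) + (z *v a) \<bullet> (g y *v (?N v *v b))" for a v b
    by (simp add: matrix_normalize inner_add_right inner_matrix_vector_transpose)
  have "(?N b *v a) \<bullet> (g y *v (z *v v)) = (z *v v) \<bullet> (g y *v (?N a *v b))"
    by (metis covariant_hess_commute inner_commute inner_metric)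
  then have "a \<bullet> (induced_metric g f x *v (connection (induced_metric g f) x v *v b)) =
      (z *v a) \<bullet> (g y *v (?N v *v b))"
    unfolding induced.koszul expand covariant_hess_commute[of v a] covariant_hess_commute[of b v]
    by simp
  then show "a \<bullet> (induced_metric g f x ** connection (induced_metric g f) x v *v b) =
      a \<bullet> (transpose z ** (g y ** ?N v) *v b)"
    by (simp add: inner_matrix_vector_transpose flip: matrix_vector_mul_assoc)
qed

lemma sff_mat_eq:
  "sff_mat g f x i = covariant_hess (axis i 1) - z ** connection (induced_metric g f) x (axis i 1)"
proof -
  have "(connection g y (z *v axis i 1) ** z) $ a $ j =
      (\<Sum>t\<in>UNIV. \<Sum>d\<in>UNIV. christoffel g y a t d * z $ t $ j * z $ d $ i)" for a j
  proof -
    have "(connection g y (z *v axis i 1) ** z) $ a $ j =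
        (connection g y (z *v axis i 1) *v (z *v axis j 1)) $ a"
      by (simp only: matrix_vector_mul_assoc matrix_vector_mult_axis)
    also have "\<dots> = (connection g y (z *v axis j 1) *v (z *v axis i 1)) $ a"
      by (simp only: ambient.connection_commute[of "z *v axis i 1"])
    also have "\<dots> = (\<Sum>d\<in>UNIV. \<Sum>t\<in>UNIV. christoffel g y a t d * z $ t $ j * z $ d $ i)"
      unfolding matrix_vector_mult_def[of "connection g y (z *v axis j 1)"]
      by (simp add: connection_def matrix_vector_mult_axis sum_distrib_right)
    also have "\<dots> = (\<Sum>t\<in>UNIV. \<Sum>d\<in>UNIV. christoffel g y a t d * z $ t $ j * z $ d $ i)"
      by (rule sum.swap)
    finally show ?thesis .
  qed
  moreover have "connection (induced_metric g f) x (axis i 1) $ k $ j =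
      christoffel (\<lambda>u. hmat (g (f u)) (Dfz f u)) x k i j" for k j
    by (simp add: connection_axis induced_metric_def[abs_def])
  ultimately show ?thesis
    by (simp add: vec_eq_iff sff_mat_def sff_def covariant_hess_def D2f_axis hess_def
        matrix_matrix_mult_def[of z] mult.commute)
qed

lemma hess_decomposition:
  "hess f x i = sff_mat g f x i + z ** connection (induced_metric g f) x (axis i 1)
     - connection g y (z *v axis i 1) ** z"
  by (simp add: sff_mat_eq covariant_hess_def D2f_axis)

lemma sff_mat_commute: "sff_mat g f x i *v axis j 1 = sff_mat g f x j *v axis i 1"
  using covariant_hess_commute[of "axis i 1" "axis j 1"]
    induced.connection_commute[of "axis i 1" "axis j 1"]
  by (simp add: sff_mat_eq matrix_normalize)

lemma sff_mat_normal: "transpose (sff_mat g f x i) ** (g y ** z) = 0"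
proof -
  have "transpose z ** (g y ** sff_mat g f x i) = 0"
    using lower_induced_connection[of "axis i 1"]
    by (simp add: sff_mat_eq induced_metric_def hmat_eq matrix_normalize)
  from arg_cong[OF this, of transpose] show ?thesis
    by (simp add: matrix_normalize transpose_metric)
qed

end

subsection \<open>Mean curvature of an immersion\<close>

locale randers_immersion = immersion_in_navigation V g W U f x
  for V :: "(real^'m) set" and g W and U :: "(real^'n) set" and f x +
  fixes vt :: volform
begin

abbreviation "r0 \<equiv> rho_deriv 0 vt g W y z"
abbreviation "r1 \<equiv> rho_deriv 1 vt g W y z"
abbreviation "r2 \<equiv> rho_deriv 2 vt g W y z"
abbreviation "L \<equiv> log_chi_deriv vt CARD('n) (nrm2 g W y)"
abbreviation "p \<equiv> low g W y"
abbreviation "u \<equiv> tangent_part (g y) z p"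
abbreviation "\<pi> \<equiv> conormal_part (g y) z p"
abbreviation "P \<equiv> transpose (normal_proj (g y) z)"
abbreviation "R \<equiv> cov_mat g W y"
abbreviation "\<omega> \<equiv> grad_nrm2 g W y"
abbreviation "N \<equiv> sff_mat g f x"

definition rho_mean_curvature :: "'m \<Rightarrow> real" where
  "rho_mean_curvature c =
     L * (2 * r1 * \<pi> $ c * (\<omega> \<bullet> (z *v u)) - r0 * (P *v \<omega>) $ c)
     + (2 * r2 * \<pi> $ c * (\<omega> \<bullet> (z *v u)) - r1 * (P *v \<omega>) $ c)
     - 4 * r1 * (P *v (R *v (z *v u))) $ c
     - (\<Sum>i\<in>UNIV. 2 * r1 * \<pi> $ c * (cometric (g y) z *v (transpose (N i) *v p)) $ i
       + r0 * (cometric (g y) z *v (transpose (N i) *v (g y *v axis c 1))) $ i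
       + 4 * r2 * \<pi> $ c * (u $ i * (p \<bullet> (N i *v u))) - 2 * r1 * (u $ i * (g y *v (N i *v u)) $ c))"

lemma meancurv_eq_variation:
  "meancurv vt g W f x c = (var_integrand r0 r1 L (g y) z p (jet_velocity g W y (axis c 1, 0))
    - (\<Sum>i\<in>UNIV. var_momentum r0 r1 r2 L (g y) z p (jet_velocity g W y (z *v axis i 1, hess f x i))
        (outer (axis c 1) (axis i 1)))) / r0"
proof -
  let ?F = "Fcal vt g W" and ?q = "(y, z)" and ?v = "Fcal_vol vt g W y z"
  note F' = pd_Fcal_frame_has_derivative[OF fx inj_Dfz, of vt]
  have euler_lagrange: "meancurv vt g W f x c = (pd ?F (dirX c) ?q
      - (\<Sum>i\<in>UNIV. pd (pd ?F (dirZ c i)) (z *v axis i 1, hess f x i) ?q)) / ?F ?q"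
  proof (rule meancurv_eq_euler_lagrange)
    show "open (V \<times> {z :: real^'n^'m. inj ((*v) z)})" by (rule open_jet_domain)
    show "?q \<in> V \<times> {z. inj ((*v) z)}" using fx inj_Dfz by simp
    show "?F differentiable (at r)" if "r \<in> V \<times> {z. inj ((*v) z)}" for r
      using that by (auto intro: differentiableI[OF Fcal_has_derivative])
    show "pd ?F (0, Y) differentiable (at ?q)" for Y
      by (rule differentiableI[OF F'])
  qed
  have base: "pd ?F (dirX c) ?q =
      ?v * var_integrand r0 r1 L (g y) z p (jet_velocity g W y (axis c 1, 0))"
    unfolding dirX_def by (rule pd_eq[OF Fcal_has_derivative[OF fx inj_Dfz]])
  have fibre: "pd (pd ?F (dirZ c i)) h ?q =
      ?v * var_momentum r0 r1 r2 L (g y) z p (jet_velocity g W y h) (outer (axis c 1) (axis i 1))"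
    for h i
    unfolding dirZ_def axis_axis_eq_outer by (rule pd_eq[OF F'])
  show ?thesis
    unfolding euler_lagrange base fibre Fcal_eq_rho_deriv
      sum_distrib_left[symmetric] right_diff_distrib[symmetric]
    using Fcal_vol_pos[OF fx inj_Dfz, of vt] by simp
qed

lemma meancurv_eq: "meancurv vt g W f x c = rho_mean_curvature c / r0"
proof -
  have "meancurv vt g W f x c * r0 = rho_mean_curvature c"
    unfolding meancurv_eq_variation hess_decomposition jet_velocity_def case_prod_conv
    unfolding euler_lagrange_covariant[OF ambient.connection_commute induced.connection_commute]
      euler_lagrange_skew[OF cov_mat_skew[OF fx]]
      sum_var_momentum_normal[OF sff_mat_normal sff_mat_commute]
      rho_mean_curvature_def
    using rho_deriv_pos[OF fx inj_Dfz, of vt] by simp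
  then show ?thesis
    using rho_deriv_pos[OF fx inj_Dfz, of vt] by (simp add: field_simps)
qed

end

subsection \<open>The index form of the right-hand side\<close>

lemma transpose_mult_vec_nth: "(transpose M *v x) $ c = (\<Sum>e\<in>UNIV. M $ e $ c * x $ e)"
  by (simp add: matrix_vector_mult_def transpose_def)

lemma Amat_nth: "Amat G z $ i $ a = (\<Sum>j\<in>UNIV. cometric G z $ i $ j * z $ a $ j)"
  by (simp add: Amat_def matrix_matrix_mult_def transpose_def)

lemma Bmat_nth:
  "Bmat G z $ a $ b = (\<Sum>i\<in>UNIV. \<Sum>j\<in>UNIV. cometric G z $ i $ j * z $ a $ i * z $ b $ j)"
  by (simp add: Bmat_def matrix_matrix_mult_def Amat_nth sum_distrib_left mult_ac)

lemma normal_proj_nth: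
  "normal_proj G z $ a $ b = kd a b - (\<Sum>d\<in>UNIV. Bmat G z $ a $ d * G $ d $ b)"
proof -
  have "z ** tangent_coord G z = Bmat G z ** G"
    by (simp add: tangent_coord_def Bmat_def matrix_mul_assoc)
  then show ?thesis by (simp add: normal_proj_def kd_def mat_def matrix_matrix_mult_def)
qed

lemma conormal_part_nth: "conormal_part G z p $ c = (\<Sum>b\<in>UNIV. p $ b * normal_proj G z $ b $ c)"
  by (simp add: conormal_part_def transpose_mult_vec_nth mult.commute)

lemma frame_tangent_part_nth: "(z *v tangent_part G z p) $ e = (\<Sum>d\<in>UNIV. Bmat G z $ e $ d * p $ d)"
proof -
  have "z *v tangent_part G z p = Bmat G z *v p"
    by (simp add: tangent_part_def Bmat_def matrix_vector_mul_assoc)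
  then show ?thesis by (simp add: matrix_vector_mult_def)
qed

lemma sum_Bmat_conormal_part:
  "(\<Sum>d\<in>UNIV. \<Sum>t\<in>UNIV. Bmat G z $ e $ d * p $ d * p $ t * normal_proj G z $ t $ c) =
     (z *v tangent_part G z p) $ e * conormal_part G z p $ c"
  by (simp add: frame_tangent_part_nth conormal_part_nth sum_product mult_ac)

lemma sum_Amat_Amat:
  "(\<Sum>d\<in>UNIV. \<Sum>t\<in>UNIV. p $ d * p $ t * Amat G z $ i $ d * Amat G z $ j $ t) =
     tangent_part G z p $ i * tangent_part G z p $ j"
  by (simp add: tangent_part_def matrix_vector_mult_def sum_product mult_ac)

lemma sum_gradient_term:
  fixes P :: "real^'k^'m" and R :: "real^'m^'l"
  shows "(\<Sum>e\<in>UNIV. \<Sum>a\<in>UNIV. (2 * s * (x $ e * t) - v * P $ e $ c) * R $ a $ e * W $ a) =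
     2 * s * t * ((transpose R *v W) \<bullet> x) - v * (transpose P *v (transpose R *v W)) $ c"
proof -
  have "(\<Sum>a\<in>UNIV. k * R $ a $ e * W $ a) = k * (transpose R *v W) $ e" for k e
    by (simp add: transpose_mult_vec_nth sum_distrib_left mult.assoc)
  then show ?thesis
    by (simp only: transpose_mult_vec_nth[of P])
      (simp add: inner_vec_def sum_distrib_left algebra_simps flip: sum_subtractf)
qed

lemma sum_covariant_derivative_term:
  "(\<Sum>e\<in>UNIV. \<Sum>b\<in>UNIV. \<Sum>a\<in>UNIV. Bmat G z $ e $ b * R $ a $ e * p $ b * normal_proj G z $ a $ c) =
     (transpose (normal_proj G z) *v (R *v (z *v tangent_part G z p))) $ c"
proof -
  have "(\<Sum>b\<in>UNIV. \<Sum>a\<in>UNIV. Bmat G z $ e $ b * R $ a $ e * p $ b * normal_proj G z $ a $ c) =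
      (\<Sum>a\<in>UNIV. normal_proj G z $ a $ c * (R $ a $ e * (z *v tangent_part G z p) $ e))" for e
    unfolding frame_tangent_part_nth by (subst sum.swap) (simp add: sum_distrib_left mult_ac)
  then have "(\<Sum>e\<in>UNIV. \<Sum>b\<in>UNIV. \<Sum>a\<in>UNIV.
        Bmat G z $ e $ b * R $ a $ e * p $ b * normal_proj G z $ a $ c) =
      (\<Sum>e\<in>UNIV. \<Sum>a\<in>UNIV. normal_proj G z $ a $ c * (R $ a $ e * (z *v tangent_part G z p) $ e))"
    by simp
  also have "\<dots> = (\<Sum>a\<in>UNIV. normal_proj G z $ a $ c * (R *v (z *v tangent_part G z p)) $ a)"
    by (subst sum.swap) (simp add: matrix_vector_mult_def[of R] sum_distrib_left)
  finally show ?thesis by (simp only: transpose_mult_vec_nth)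
qed

lemma sum_second_fundamental_form_term:
  fixes G :: "real^'m^'m" and N :: "real^'n^'m" and C :: "real^'n^'n"
  assumes G: "transpose G = G"
  shows "(\<Sum>j\<in>UNIV. \<Sum>a\<in>UNIV. (C $ i $ j * (2 * r1 * p $ a * t + r0 * G $ c $ a)
      + 2 * (u $ i * u $ j) * (2 * r2 * p $ a * t - r1 * G $ c $ a)) * N $ a $ j) =
    2 * r1 * t * (C *v (transpose N *v p)) $ i + r0 * (C *v (transpose N *v (G *v axis c 1))) $ i
      + 4 * r2 * t * (u $ i * (p \<bullet> (N *v u))) - 2 * r1 * (u $ i * (G *v (N *v u)) $ c)"
proof -
  let ?sum = "\<lambda>k q. \<Sum>j\<in>UNIV. \<Sum>a\<in>UNIV. k j * q $ a * N $ a $ j"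
  have G_row: "G $ c $ a = (G *v axis c 1) $ a" for a
    using arg_cong[OF G, of "\<lambda>M. M $ c $ a"] by (simp add: matrix_vector_mult_axis transpose_def)
  have cometric: "?sum (\<lambda>j. C $ i $ j) q = (C *v (transpose N *v q)) $ i" for q
    unfolding matrix_vector_mult_def[of C]
    by (simp add: transpose_mult_vec_nth sum_distrib_left mult_ac)
  have tangent: "?sum (\<lambda>j. u $ j) q = q \<bullet> (N *v u)" for q
    by (subst sum.swap) (simp add: inner_vec_def matrix_vector_mult_def sum_distrib_left mult_ac)
  have "(G *v axis c 1) \<bullet> (N *v u) = (G *v (N *v u)) $ c"
    by (simp add: inner_matrix_vector_transpose G inner_axis')
  moreover have "(\<Sum>j\<in>UNIV. \<Sum>a\<in>UNIV. (C $ i $ j * (2 * r1 * p $ a * t + r0 * G $ c $ a)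
      + 2 * (u $ i * u $ j) * (2 * r2 * p $ a * t - r1 * G $ c $ a)) * N $ a $ j) =
    2 * r1 * t * ?sum (\<lambda>j. C $ i $ j) p + r0 * ?sum (\<lambda>j. C $ i $ j) (G *v axis c 1)
      + 4 * r2 * t * (u $ i * ?sum (\<lambda>j. u $ j) p)
      - 2 * r1 * (u $ i * ?sum (\<lambda>j. u $ j) (G *v axis c 1))"
    unfolding G_row sum_distrib_left sum.distrib[symmetric] sum_subtractf[symmetric]
    by (intro sum.cong refl) algebra
  ultimately show ?thesis by (simp only: cometric tangent)
qed

lemma (in randers_immersion) rhs_eq: "rhs vt g W f x c = rho_mean_curvature c / r0"
proof -
  let ?K = "\<lambda>s v. 2 * s * \<pi> $ c * (\<omega> \<bullet> (z *v u)) - v * (P *v \<omega>) $ c"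
  have K: "2 * s * \<pi> $ c * ((transpose R *v W y) \<bullet> (z *v u)) - v * (P *v (transpose R *v W y)) $ c
      = ?K s v / 2" for s v
    by (simp add: grad_nrm2_def matrix_vector_mult.scaleR_right)
  have covWl: "covWl g W y = (\<lambda>a e. R $ a $ e)" and lowW: "lowW g W y = (\<lambda>a. p $ a)"
    and sff: "sff g f x = (\<lambda>a i j. N i $ a $ j)"
    by (simp_all add: fun_eq_iff cov_mat_def lowW_eq sff_mat_def)
  have rho: "rho vt CARD('n) (frak_s g W y z) = r0" "deriv (rho vt CARD('n)) (frak_s g W y z) = r1"
    "deriv (deriv (rho vt CARD('n))) (frak_s g W y z) = r2"
    by (simp_all add: rho_deriv_def numeral_2_eq_2)
  have "rhs vt g W f x c = 2 * L / r0 * (?K r1 r0 / 2)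
      - 1 / r0 * (4 * r1 * (P *v (R *v (z *v u))) $ c - 2 * (?K r2 r1 / 2))
      - 1 / r0 * (\<Sum>i\<in>UNIV. 2 * r1 * \<pi> $ c * (cometric (g y) z *v (transpose (N i) *v p)) $ i
       + r0 * (cometric (g y) z *v (transpose (N i) *v (g y *v axis c 1))) $ i
       + 4 * r2 * \<pi> $ c * (u $ i * (p \<bullet> (N i *v u))) - 2 * r1 * (u $ i * (g y *v (N i *v u)) $ c))"
    unfolding rhs_def Let_def rho log_chi_deriv_def[symmetric] covWl lowW sff
      Amat_nth[symmetric] Bmat_nth[symmetric] normal_proj_nth[symmetric]
      sum_Bmat_conormal_part sum_Amat_Amat conormal_part_nth[symmetric]
      sum_gradient_term sum_covariant_derivative_term K cometric_def[symmetric]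
      sum_second_fundamental_form_term[OF transpose_metric]
    by (rule refl)
  moreover have "2 * l / k * (a / 2) - 1 / k * (b - 2 * (a' / 2)) - 1 / k * d =
      (l * a + a' - b - d) / k" for k l a a' b d :: real
    by (simp add: diff_divide_distrib add_divide_distrib)
  ultimately show ?thesis by (simp only: rho_mean_curvature_def)
qed

theorem theorem2p2:
  fixes vt :: volform
    and g :: "real^'m::finite \<Rightarrow> real^'m^'m"
    and W :: "real^'m \<Rightarrow> real^'m"
    and f :: "real^'n::finite \<Rightarrow> real^'m"
    and U :: "(real^'n) set" and V :: "(real^'m) set"
  assumes "open U" and "open V"
    and "riemannian_on V g"
    and "\<forall>a. smooth_on V (\<lambda>y. W y $ a)"
    and "\<forall>y\<in>V. nrm2 g W y < 1"
    and "killing_on V g W"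
    and "\<forall>a. smooth_on U (\<lambda>x. f x $ a)"
    and "f ` U \<subseteq> V"
    and "\<forall>x\<in>U. \<forall>v. Dfz f x *v v = 0 \<longrightarrow> v = 0"
    and "x \<in> U"
  shows "meancurv vt g W f x c = rhs vt g W f x c"
proof -
  have "inj ((*v) (Dfz f x))"
    using assms(9,10) by (simp add: linear_injective_0)
  then interpret randers_immersion V g W U f x vt
    using assms by unfold_locales auto
  show ?thesis by (simp only: meancurv_eq rhs_eq)
qed

end
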